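(* Let $\mathcal{C}$ be an extriangulated category with a fixed full additive subcategory $\mathcal{T}$, stable under isomorphisms and under taking direct summands, such that: (1) every $T\in\mathcal{T}$ is projective in $\mathcal{C}$; (2) for each $T\in\mathcal{T}$, the morphism $T\to0$ is an inflation; (3) for each $X\in\mathcal{C}$ there is a conflation $T_1^X\rightarrowtail T_0^X\twoheadrightarrow X$ with $T_0^X,T_1^X\in\mathcal{T}$. For each $X$ fix such a conflation and define the index $\mathrm{ind}_{\mathcal{T}}X:=[T_0^X]-[T_1^X]\in K_0(\mathcal{T})$. Then the assignment $X\mapsto\mathrm{ind}_{\mathcal{T}}X$ is well-defined (independent of the choice of conflation) and induces an isomorphism of abelian groups \[ \mathrm{ind}_{\mathcal{T}}:K_0(\mathcal{C})\overset{\cong}{\longrightarrow}K_0(\mathcal{T}). \]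
   Context: $K_0(\mathcal{C})$ is the Grothendieck group of $\mathcal{C}$: the free abelian group on symbols $[X]$, $X\in\mathcal{C}$, modulo $[X]-[Y]+[Z]$ for each conflation $X\rightarrowtail Y\twoheadrightarrow Z$. $\mathcal{T}$ is extension-closed, and its induced extriangulated structure splits, so $K_0(\mathcal{T})$ is the split Grothendieck group of $\mathcal{T}$ (relations $[T\oplus T']=[T]+[T']$). An extriangulated category (Nakaoka–Palu) is a triple $(\mathcal{C},\mathbb{E},\mathfrak{s})$ where $\mathcal{C}$ is an additive category and: (ET1) $\mathbb{E}:\mathcal{C}^{op}\times\mathcal{C}\to\mathrm{Ab}$ is an additive bifunctor. Elements $\delta\in\mathbb{E}(Z,X)$ are called extensions; for $f:X\to X'$, $h:Z'\to Z$ write $f_*\delta=\mathbb{E}(Z,f)(\delta)$, $h^*\delta=\mathbb{E}(h,X)(\delta)$. A morphism $\delta\to\delta'$ from $\delta\in\mathbb{E}(Z,X)$ to $\delta'\in\mathbb{E}(Z',X')$ is a pair $(f:X\to X',h:Z\to Z')$ with $f_*\delta=h^*\delta'$. (ET2) $\mathfrak{s}$ is an additive realization: it assigns to each $\delta\in\mathbb{E}(Z,X)$ a class $\mathfrak{s}(\delta)=[X\xrightarrow{x}Y\xrightarrow{y}Z]$ of sequences up to isomorphism of the middle term compatible with identities on $X,Z$; for any morphism $(f,h):\delta\to\delta'$ with $\mathfrak{s}(\delta')=[X'\xrightarrow{x'}Y'\xrightarrow{y'}Z']$ there is $g:Y\to Y'$ with $gx=x'f$, $hy=y'g$; $\mathfrak{s}(0)=[X\to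 X\oplus Z\to Z]$; and $\mathfrak{s}(\delta\oplus\delta')=\mathfrak{s}(\delta)\oplus\mathfrak{s}(\delta')$. (ET3) If $\delta,\delta'$ are realized by $X\xrightarrow{x}Y\xrightarrow{y}Z$, $X'\xrightarrow{x'}Y'\xrightarrow{y'}Z'$ and $gx=x'f$, there is $h:Z\to Z'$ with $(f,h):\delta\to\delta'$ a morphism and $hy=y'g$; and the dual (ET3)$^{op}$. (ET4) If $\delta\in\mathbb{E}(Z',X)$, $\delta'\in\mathbb{E}(X',Y)$ are realized by $X\xrightarrow{f}Y\xrightarrow{f'}Z'$ and $Y\xrightarrow{g}Z\xrightarrow{g'}X'$, there are an object $Y'$, morphisms $h=gf:X\to Z$, $h':Z\to Y'$, $d:Z'\to Y'$, $e:Y'\to X'$ with $h'g=df'$, $eh'=g'$, and $\delta''\in\mathbb{E}(Y',X)$ realized by $X\xrightarrow{h}Z\xrightarrow{h'}Y'$, such that $Z'\xrightarrow{d}Y'\xrightarrow{e}X'$ realizes $f'_*\delta'$, $d^*\delta''=\delta$ and $f_*\delta''=e^*\delta'$; and the dual (ET4)$^{op}$. A sequence $X\to Y\to Z$ realizing some extension is a conflation, written $X\rightarrowtail Y\twoheadrightarrow Z$; then $X\to Y$ is an inflation and $Y\to Z$ a deflation. $P$ is projective if $\mathbb{E}(P,-)=0$. *)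

theory Defs
  imports "HOL-Algebra.Free_Abelian_Groups" "HOL-Algebra.Generated_Groups"
begin

section \<open>Additive categories\<close>

text \<open>
  All abelian groups (the Hom-groups, the groups of extensions, the Grothendieck groups) are
  commutative groups of HOL-Algebra and hence written multiplicatively: \<open>\<one>\<^bsub>Hom C X Y\<^esub>\<close> is the zero
  morphism from \<open>X\<close> to \<open>Y\<close>, and \<open>f \<otimes>\<^bsub>Hom C X Y\<^esub> f'\<close> is the sum of two parallel morphisms.
  Hom-groups of different pairs of objects may overlap as sets.
\<close>

record ('o, 'm) cat =
  Obj :: "'o set"
  Hom :: "'o \<Rightarrow> 'o \<Rightarrow> 'm monoid"
  Cmp :: "'m \<Rightarrow> 'm \<Rightarrow> 'm"  (infixl \<open>\<cdot>\<index>\<close> 75)  \<comment> \<open>\<open>g \<cdot>\<^bsub>C\<^esub> f\<close> is \<open>g\<close> after \<open>f\<close>\<close>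
  Idt :: "'o \<Rightarrow> 'm"

definition zero_object :: "('o, 'm, 'z) cat_scheme \<Rightarrow> 'o \<Rightarrow> bool" where
  "zero_object C O' \<longleftrightarrow> O' \<in> Obj C \<and>
     (\<forall>X\<in>Obj C. trivial_group (Hom C O' X) \<and> trivial_group (Hom C X O'))"

definition iso_arrow :: "('o, 'm, 'z) cat_scheme \<Rightarrow> 'o \<Rightarrow> 'o \<Rightarrow> 'm \<Rightarrow> bool" where
  "iso_arrow C X Y f \<longleftrightarrow> f \<in> carrier (Hom C X Y) \<and>
     (\<exists>g\<in>carrier (Hom C Y X). g \<cdot>\<^bsub>C\<^esub> f = Idt C X \<and> f \<cdot>\<^bsub>C\<^esub> g = Idt C Y)"

definition biproduct ::
    "('o, 'm, 'z) cat_scheme \<Rightarrow> 'o \<Rightarrow> 'o \<Rightarrow> 'o \<Rightarrow> 'm \<Rightarrow> 'm \<Rightarrow> 'm \<Rightarrow> 'm \<Rightarrow> bool" where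
  "biproduct C A B S i j p q \<longleftrightarrow>
     A \<in> Obj C \<and> B \<in> Obj C \<and> S \<in> Obj C \<and>
     i \<in> carrier (Hom C A S) \<and> j \<in> carrier (Hom C B S) \<and>
     p \<in> carrier (Hom C S A) \<and> q \<in> carrier (Hom C S B) \<and>
     p \<cdot>\<^bsub>C\<^esub> i = Idt C A \<and> q \<cdot>\<^bsub>C\<^esub> j = Idt C B \<and>
     q \<cdot>\<^bsub>C\<^esub> i = \<one>\<^bsub>Hom C A B\<^esub> \<and> p \<cdot>\<^bsub>C\<^esub> j = \<one>\<^bsub>Hom C B A\<^esub> \<and>
     (i \<cdot>\<^bsub>C\<^esub> p) \<otimes>\<^bsub>Hom C S S\<^esub> (j \<cdot>\<^bsub>C\<^esub> q) = Idt C S"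

locale additive_category =
  fixes C :: "('o, 'm, 'z) cat_scheme" (structure)
  assumes Hom_comm_group: "\<lbrakk>X \<in> Obj C; Y \<in> Obj C\<rbrakk> \<Longrightarrow> comm_group (Hom C X Y)"
    and Idt_closed: "X \<in> Obj C \<Longrightarrow> Idt C X \<in> carrier (Hom C X X)"
    and Cmp_closed:
      "\<lbrakk>X \<in> Obj C; Y \<in> Obj C; Z \<in> Obj C; f \<in> carrier (Hom C X Y); g \<in> carrier (Hom C Y Z)\<rbrakk>
        \<Longrightarrow> g \<cdot> f \<in> carrier (Hom C X Z)"
    and Cmp_assoc:
      "\<lbrakk>W \<in> Obj C; X \<in> Obj C; Y \<in> Obj C; Z \<in> Obj C;
        f \<in> carrier (Hom C W X); g \<in> carrier (Hom C X Y); h \<in> carrier (Hom C Y Z)\<rbrakk>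
        \<Longrightarrow> (h \<cdot> g) \<cdot> f = h \<cdot> (g \<cdot> f)"
    and Cmp_Idt_left:
      "\<lbrakk>X \<in> Obj C; Y \<in> Obj C; f \<in> carrier (Hom C X Y)\<rbrakk> \<Longrightarrow> Idt C Y \<cdot> f = f"
    and Cmp_Idt_right:
      "\<lbrakk>X \<in> Obj C; Y \<in> Obj C; f \<in> carrier (Hom C X Y)\<rbrakk> \<Longrightarrow> f \<cdot> Idt C X = f"
    and Cmp_add_right:
      "\<lbrakk>X \<in> Obj C; Y \<in> Obj C; Z \<in> Obj C; f \<in> carrier (Hom C X Y); f' \<in> carrier (Hom C X Y);
        g \<in> carrier (Hom C Y Z)\<rbrakk>
        \<Longrightarrow> g \<cdot> (f \<otimes>\<^bsub>Hom C X Y\<^esub> f') = (g \<cdot> f) \<otimes>\<^bsub>Hom C X Z\<^esub> (g \<cdot> f')"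
    and Cmp_add_left:
      "\<lbrakk>X \<in> Obj C; Y \<in> Obj C; Z \<in> Obj C; f \<in> carrier (Hom C X Y);
        g \<in> carrier (Hom C Y Z); g' \<in> carrier (Hom C Y Z)\<rbrakk>
        \<Longrightarrow> (g \<otimes>\<^bsub>Hom C Y Z\<^esub> g') \<cdot> f = (g \<cdot> f) \<otimes>\<^bsub>Hom C X Z\<^esub> (g' \<cdot> f)"
    and ex_zero_object: "\<exists>O'. zero_object C O'"
    and ex_biproduct:
      "\<lbrakk>A \<in> Obj C; B \<in> Obj C\<rbrakk> \<Longrightarrow> \<exists>S i j p q. biproduct C A B S i j p q"


section \<open>Extriangulated categories\<close>

text \<open>
  \<open>Ext C Z X\<close> is the group \<open>\<bbbE>(Z, X)\<close>; \<open>Push C f \<delta>\<close> is \<open>f\<^sub>*\<delta>\<close> and \<open>Pull C h \<delta>\<close> is \<open>h\<^sup>*\<delta>\<close>.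
  \<open>Rlz C Z X \<delta>\<close> is the class \<open>\<ss>(\<delta>)\<close>, where a triple \<open>(x, Y, y)\<close> stands for the sequence
  \<open>X \<rightarrow> Y \<rightarrow> Z\<close> with maps \<open>x\<close> and \<open>y\<close>.
\<close>

record ('o, 'm, 'e) extri = "('o, 'm) cat" +
  Ext :: "'o \<Rightarrow> 'o \<Rightarrow> 'e monoid"
  Push :: "'m \<Rightarrow> 'e \<Rightarrow> 'e"
  Pull :: "'m \<Rightarrow> 'e \<Rightarrow> 'e"
  Rlz :: "'o \<Rightarrow> 'o \<Rightarrow> 'e \<Rightarrow> ('m \<times> 'o \<times> 'm) set"

definition sequences :: "('o, 'm, 'z) cat_scheme \<Rightarrow> 'o \<Rightarrow> 'o \<Rightarrow> ('m \<times> 'o \<times> 'm) set" where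
  "sequences C X Z =
     {(x, Y, y). Y \<in> Obj C \<and> x \<in> carrier (Hom C X Y) \<and> y \<in> carrier (Hom C Y Z)}"

definition seq_equiv ::
    "('o, 'm, 'z) cat_scheme \<Rightarrow> 'o \<Rightarrow> 'o \<Rightarrow> (('m \<times> 'o \<times> 'm) \<times> ('m \<times> 'o \<times> 'm)) set" where
  "seq_equiv C X Z =
     {((x, Y, y), (x', Y', y')).
        (x, Y, y) \<in> sequences C X Z \<and> (x', Y', y') \<in> sequences C X Z \<and>
        (\<exists>g. iso_arrow C Y Y' g \<and> g \<cdot>\<^bsub>C\<^esub> x = x' \<and> y' \<cdot>\<^bsub>C\<^esub> g = y)}"

definition realizes :: "('o, 'm, 'e) extri \<Rightarrow> 'o \<Rightarrow> 'o \<Rightarrow> 'e \<Rightarrow> 'm \<Rightarrow> 'o \<Rightarrow> 'm \<Rightarrow> bool" where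
  "realizes C Z X \<delta> x Y y \<longleftrightarrow>
     X \<in> Obj C \<and> Z \<in> Obj C \<and> \<delta> \<in> carrier (Ext C Z X) \<and> (x, Y, y) \<in> Rlz C Z X \<delta>"

definition ext_morphism ::
    "('o, 'm, 'e) extri \<Rightarrow> 'o \<Rightarrow> 'o \<Rightarrow> 'e \<Rightarrow> 'o \<Rightarrow> 'o \<Rightarrow> 'e \<Rightarrow> 'm \<Rightarrow> 'm \<Rightarrow> bool" where
  "ext_morphism C Z X \<delta> Z' X' \<delta>' f h \<longleftrightarrow>
     f \<in> carrier (Hom C X X') \<and> h \<in> carrier (Hom C Z Z') \<and> Push C f \<delta> = Pull C h \<delta>'"

text \<open>
  For biproducts \<open>SX = X \<oplus> X'\<close> (with injections \<open>i, i'\<close>) and \<open>SZ = Z \<oplus> Z'\<close> (with projections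
  \<open>r, r'\<close>), the element of \<open>\<bbbE>(SZ, SX)\<close> corresponding to \<open>(\<delta>, 0, 0, \<delta>')\<close> in
  \<open>\<bbbE>(Z, X) \<oplus> \<bbbE>(Z, X') \<oplus> \<bbbE>(Z', X) \<oplus> \<bbbE>(Z', X')\<close> is \<open>i\<^sub>* r\<^sup>* \<delta> + i'\<^sub>* r'\<^sup>* \<delta>'\<close>.
\<close>

definition ext_sum ::
    "('o, 'm, 'e) extri \<Rightarrow> 'o \<Rightarrow> 'o \<Rightarrow> 'm \<Rightarrow> 'm \<Rightarrow> 'm \<Rightarrow> 'm \<Rightarrow> 'e \<Rightarrow> 'e \<Rightarrow> 'e" where
  "ext_sum C SZ SX i i' r r' \<delta> \<delta>' =
     Push C i (Pull C r \<delta>) \<otimes>\<^bsub>Ext C SZ SX\<^esub> Push C i' (Pull C r' \<delta>')"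

text \<open>
  The direct sum \<open>f \<oplus> f'\<close> as a morphism from \<open>A \<oplus> A'\<close> (with projections \<open>p, p'\<close>) to
  \<open>B \<oplus> B'\<close> (with injections \<open>i, i'\<close>).
\<close>

definition arrow_sum ::
    "('o, 'm, 'z) cat_scheme \<Rightarrow> 'o \<Rightarrow> 'o \<Rightarrow> 'm \<Rightarrow> 'm \<Rightarrow> 'm \<Rightarrow> 'm \<Rightarrow> 'm \<Rightarrow> 'm \<Rightarrow> 'm" where
  "arrow_sum C SA SB p p' i i' f f' =
     (i \<cdot>\<^bsub>C\<^esub> f \<cdot>\<^bsub>C\<^esub> p) \<otimes>\<^bsub>Hom C SA SB\<^esub> (i' \<cdot>\<^bsub>C\<^esub> f' \<cdot>\<^bsub>C\<^esub> p')"

definition ET3 :: "('o, 'm, 'e) extri \<Rightarrow> bool" where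
  "ET3 C \<longleftrightarrow>
     (\<forall>X Y Z X' Y' Z' x y x' y' \<delta> \<delta>' f g.
        realizes C Z X \<delta> x Y y \<and> realizes C Z' X' \<delta>' x' Y' y' \<and>
        f \<in> carrier (Hom C X X') \<and> g \<in> carrier (Hom C Y Y') \<and> g \<cdot>\<^bsub>C\<^esub> x = x' \<cdot>\<^bsub>C\<^esub> f
        \<longrightarrow> (\<exists>h. ext_morphism C Z X \<delta> Z' X' \<delta>' f h \<and> h \<cdot>\<^bsub>C\<^esub> y = y' \<cdot>\<^bsub>C\<^esub> g))"

definition ET4 :: "('o, 'm, 'e) extri \<Rightarrow> bool" where
  "ET4 C \<longleftrightarrow>
     (\<forall>X Y Z X' Z' f f' g g' \<delta> \<delta>'.
        realizes C Z' X \<delta> f Y f' \<and> realizes C X' Y \<delta>' g Z g'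
        \<longrightarrow> (\<exists>Y' h' d e \<delta>''.
              Y' \<in> Obj C \<and> h' \<in> carrier (Hom C Z Y') \<and>
              d \<in> carrier (Hom C Z' Y') \<and> e \<in> carrier (Hom C Y' X') \<and>
              h' \<cdot>\<^bsub>C\<^esub> g = d \<cdot>\<^bsub>C\<^esub> f' \<and> e \<cdot>\<^bsub>C\<^esub> h' = g' \<and>
              realizes C Y' X \<delta>'' (g \<cdot>\<^bsub>C\<^esub> f) Z h' \<and>
              realizes C X' Z' (Push C f' \<delta>') d Y' e \<and>
              Pull C d \<delta>'' = \<delta> \<and> Push C f \<delta>'' = Pull C e \<delta>'))"

text \<open>
  The opposite structure; \<open>ET3 (opp C)\<close> and \<open>ET4 (opp C)\<close> are the dual axioms for \<open>C\<close>.
\<close>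

definition opp :: "('o, 'm, 'e) extri \<Rightarrow> ('o, 'm, 'e) extri" where
  "opp C =
     \<lparr>Obj = Obj C, Hom = (\<lambda>X Y. Hom C Y X), Cmp = (\<lambda>g f. f \<cdot>\<^bsub>C\<^esub> g), Idt = Idt C,
      Ext = (\<lambda>Z X. Ext C X Z), Push = Pull C, Pull = Push C,
      Rlz = (\<lambda>Z X \<delta>. {(y, Y, x). (x, Y, y) \<in> Rlz C X Z \<delta>})\<rparr>"

locale extriangulated_category = additive_category C
  for C :: "('o, 'm, 'e) extri" (structure) +
  \<comment> \<open>(ET1)\<close>
  assumes Ext_comm_group: "\<lbrakk>Z \<in> Obj C; X \<in> Obj C\<rbrakk> \<Longrightarrow> comm_group (Ext C Z X)"
    and Push_hom:
      "\<lbrakk>Z \<in> Obj C; X \<in> Obj C; X' \<in> Obj C; f \<in> carrier (Hom C X X')\<rbrakk>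
        \<Longrightarrow> Push C f \<in> hom (Ext C Z X) (Ext C Z X')"
    and Pull_hom:
      "\<lbrakk>Z \<in> Obj C; Z' \<in> Obj C; X \<in> Obj C; h \<in> carrier (Hom C Z' Z)\<rbrakk>
        \<Longrightarrow> Pull C h \<in> hom (Ext C Z X) (Ext C Z' X)"
    and Push_Idt:
      "\<lbrakk>Z \<in> Obj C; X \<in> Obj C; \<delta> \<in> carrier (Ext C Z X)\<rbrakk> \<Longrightarrow> Push C (Idt C X) \<delta> = \<delta>"
    and Pull_Idt:
      "\<lbrakk>Z \<in> Obj C; X \<in> Obj C; \<delta> \<in> carrier (Ext C Z X)\<rbrakk> \<Longrightarrow> Pull C (Idt C Z) \<delta> = \<delta>"
    and Push_Cmp:
      "\<lbrakk>Z \<in> Obj C; X \<in> Obj C; X' \<in> Obj C; X'' \<in> Obj C; \<delta> \<in> carrier (Ext C Z X);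
        f \<in> carrier (Hom C X X'); f' \<in> carrier (Hom C X' X'')\<rbrakk>
        \<Longrightarrow> Push C (f' \<cdot> f) \<delta> = Push C f' (Push C f \<delta>)"
    and Pull_Cmp:
      "\<lbrakk>Z \<in> Obj C; Z' \<in> Obj C; Z'' \<in> Obj C; X \<in> Obj C; \<delta> \<in> carrier (Ext C Z X);
        h \<in> carrier (Hom C Z' Z); h' \<in> carrier (Hom C Z'' Z')\<rbrakk>
        \<Longrightarrow> Pull C (h \<cdot> h') \<delta> = Pull C h' (Pull C h \<delta>)"
    and Push_Pull:
      "\<lbrakk>Z \<in> Obj C; Z' \<in> Obj C; X \<in> Obj C; X' \<in> Obj C; \<delta> \<in> carrier (Ext C Z X);
        f \<in> carrier (Hom C X X'); h \<in> carrier (Hom C Z' Z)\<rbrakk>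
        \<Longrightarrow> Push C f (Pull C h \<delta>) = Pull C h (Push C f \<delta>)"
    and Push_add:
      "\<lbrakk>Z \<in> Obj C; X \<in> Obj C; X' \<in> Obj C; \<delta> \<in> carrier (Ext C Z X);
        f \<in> carrier (Hom C X X'); f' \<in> carrier (Hom C X X')\<rbrakk>
        \<Longrightarrow> Push C (f \<otimes>\<^bsub>Hom C X X'\<^esub> f') \<delta> = Push C f \<delta> \<otimes>\<^bsub>Ext C Z X'\<^esub> Push C f' \<delta>"
    and Pull_add:
      "\<lbrakk>Z \<in> Obj C; Z' \<in> Obj C; X \<in> Obj C; \<delta> \<in> carrier (Ext C Z X);
        h \<in> carrier (Hom C Z' Z); h' \<in> carrier (Hom C Z' Z)\<rbrakk>
        \<Longrightarrow> Pull C (h \<otimes>\<^bsub>Hom C Z' Z\<^esub> h') \<delta> = Pull C h \<delta> \<otimes>\<^bsub>Ext C Z' X\<^esub> Pull C h' \<delta>"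
  \<comment> \<open>(ET2)\<close>
    and Rlz_class:
      "\<lbrakk>Z \<in> Obj C; X \<in> Obj C; \<delta> \<in> carrier (Ext C Z X)\<rbrakk>
        \<Longrightarrow> Rlz C Z X \<delta> \<in> sequences C X Z // seq_equiv C X Z"
    and Rlz_morphism:
      "\<lbrakk>realizes C Z X \<delta> x Y y; realizes C Z' X' \<delta>' x' Y' y';
        ext_morphism C Z X \<delta> Z' X' \<delta>' f h\<rbrakk>
        \<Longrightarrow> \<exists>g\<in>carrier (Hom C Y Y'). g \<cdot> x = x' \<cdot> f \<and> h \<cdot> y = y' \<cdot> g"
    and Rlz_zero:
      "biproduct C X Z S i j p q \<Longrightarrow>
        Rlz C Z X \<one>\<^bsub>Ext C Z X\<^esub> = seq_equiv C X Z `` {(i, S, q)}"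
    and Rlz_sum:
      "\<lbrakk>realizes C Z X \<delta> x Y y; realizes C Z' X' \<delta>' x' Y' y';
        biproduct C X X' SX iX iX' pX pX';
        biproduct C Y Y' SY iY iY' pY pY';
        biproduct C Z Z' SZ iZ iZ' pZ pZ'\<rbrakk>
        \<Longrightarrow> Rlz C SZ SX (ext_sum C SZ SX iX iX' pZ pZ' \<delta> \<delta>') =
            seq_equiv C SX SZ ``
              {(arrow_sum C SX SY pX pX' iY iY' x x', SY, arrow_sum C SY SZ pY pY' iZ iZ' y y')}"
    and ET3: "ET3 C"
    and ET3_op: "ET3 (opp C)"
    and ET4: "ET4 C"
    and ET4_op: "ET4 (opp C)"

definition conflation :: "('o, 'm, 'e) extri \<Rightarrow> 'o \<Rightarrow> 'm \<Rightarrow> 'o \<Rightarrow> 'm \<Rightarrow> 'o \<Rightarrow> bool" where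
  "conflation C X x Y y Z \<longleftrightarrow> (\<exists>\<delta>. realizes C Z X \<delta> x Y y)"

definition inflation :: "('o, 'm, 'e) extri \<Rightarrow> 'o \<Rightarrow> 'o \<Rightarrow> 'm \<Rightarrow> bool" where
  "inflation C X Y x \<longleftrightarrow> (\<exists>y Z. conflation C X x Y y Z)"

definition projective :: "('o, 'm, 'e) extri \<Rightarrow> 'o \<Rightarrow> bool" where
  "projective C P \<longleftrightarrow> P \<in> Obj C \<and> (\<forall>X\<in>Obj C. trivial_group (Ext C P X))"


section \<open>Full subcategories\<close>

text \<open>
  The full subcategory on a set \<open>T\<close> of objects, with the induced extensions and realization: its
  conflations are the conflations of \<open>C\<close> all of whose terms lie in \<open>T\<close>.
\<close>

definition full_sub :: "('o, 'm, 'e) extri \<Rightarrow> 'o set \<Rightarrow> ('o, 'm, 'e) extri" where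
  "full_sub C T =
     C\<lparr>Obj := T, Rlz := (\<lambda>Z X \<delta>. {(x, Y, y). (x, Y, y) \<in> Rlz C Z X \<delta> \<and> Y \<in> T})\<rparr>"

definition full_additive_subcategory :: "('o, 'm, 'e) extri \<Rightarrow> 'o set \<Rightarrow> bool" where
  "full_additive_subcategory C T \<longleftrightarrow> T \<subseteq> Obj C \<and> additive_category (full_sub C T)"

definition iso_stable :: "('o, 'm, 'z) cat_scheme \<Rightarrow> 'o set \<Rightarrow> bool" where
  "iso_stable C T \<longleftrightarrow> (\<forall>X\<in>T. \<forall>Y\<in>Obj C. (\<exists>f. iso_arrow C X Y f) \<longrightarrow> Y \<in> T)"

definition summand_stable :: "('o, 'm, 'z) cat_scheme \<Rightarrow> 'o set \<Rightarrow> bool" where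
  "summand_stable C T \<longleftrightarrow>
     (\<forall>A B S i j p q. biproduct C A B S i j p q \<and> S \<in> T \<longrightarrow> A \<in> T \<and> B \<in> T)"


section \<open>Grothendieck groups\<close>

definition K0_relations :: "('o, 'm, 'e) extri \<Rightarrow> ('o \<Rightarrow>\<^sub>0 int) set" where
  "K0_relations C = {frag_of X - frag_of Y + frag_of Z | X Y Z. \<exists>x y. conflation C X x Y y Z}"

definition K0_kernel :: "('o, 'm, 'e) extri \<Rightarrow> ('o \<Rightarrow>\<^sub>0 int) set" where
  "K0_kernel C = generate (free_Abelian_group (Obj C)) (K0_relations C)"

definition K0 :: "('o, 'm, 'e) extri \<Rightarrow> ('o \<Rightarrow>\<^sub>0 int) set monoid" where
  "K0 C = free_Abelian_group (Obj C) Mod K0_kernel C"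

definition K0_class :: "('o, 'm, 'e) extri \<Rightarrow> 'o \<Rightarrow> ('o \<Rightarrow>\<^sub>0 int) set" where
  "K0_class C X = K0_kernel C #>\<^bsub>free_Abelian_group (Obj C)\<^esub> frag_of X"

text \<open>The element \<open>[A] - [B]\<close> of \<open>K\<^sub>0(T)\<close>, for \<open>A\<close> and \<open>B\<close> in \<open>T\<close>.\<close>

definition K0_diff :: "('o, 'm, 'e) extri \<Rightarrow> 'o set \<Rightarrow> 'o \<Rightarrow> 'o \<Rightarrow> ('o \<Rightarrow>\<^sub>0 int) set" where
  "K0_diff C T A B =
     K0_class (full_sub C T) A \<otimes>\<^bsub>K0 (full_sub C T)\<^esub>
       inv\<^bsub>K0 (full_sub C T)\<^esub> K0_class (full_sub C T) B"

text \<open>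
  The index with respect to a choice of conflations \<open>T1 X \<rightarrow> T0 X \<rightarrow> X\<close>.
\<close>

definition ind ::
    "('o, 'm, 'e) extri \<Rightarrow> 'o set \<Rightarrow> ('o \<Rightarrow> 'o) \<Rightarrow> ('o \<Rightarrow> 'o) \<Rightarrow> 'o \<Rightarrow> ('o \<Rightarrow>\<^sub>0 int) set" where
  "ind C T T0 T1 X = K0_diff C T (T0 X) (T1 X)"

end

theory Submission
  imports Defs
begin

text \<open>
  Objects of \<open>T\<close> are projective, so a conflation whose end lies in \<open>T\<close> splits: an extension of
  two objects \<open>A\<close> and \<open>P\<close> of \<open>T\<close> is isomorphic to \<open>A \<oplus> P\<close>, and its class is \<open>[A] + [P]\<close>
  (\<open>T_extension_closed\<close>). A conflation \<open>T1 X \<rightarrow> T0 X \<rightarrow> X\<close> is thus a projective resolution of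
  length one, and the index is the Euler characteristic of this resolution. The classical proof of
  the resolution theorem then applies. Schanuel's lemma shows that the index does not depend on the
  resolution (\<open>index_unique\<close>). The horseshoe lemma shows that it is additive on conflations
  (\<open>ind_additive\<close>), so it induces a homomorphism of Grothendieck groups. The inverse is induced by
  the inclusion of \<open>T\<close> (\<open>ind_iso\<close>).

  Both lemmas need the pullback of two deflations \<open>B1 \<rightarrow> Z \<leftarrow> B2\<close> with kernels \<open>A1\<close> and \<open>A2\<close>.
  It is obtained as a realization \<open>M\<close> of the extension of \<open>Z\<close> by \<open>A1 \<oplus> A2\<close> that has the two given
  extensions as components; applying (ET4) to the two split inflations \<open>A2 \<rightarrow> A1 \<oplus> A2\<close> and
  \<open>A1 \<rightarrow> A1 \<oplus> A2\<close> shows that \<open>M\<close> is an extension of \<open>B1\<close> by \<open>A2\<close> and of \<open>B2\<close> by \<open>A1\<close>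
  (\<open>pullback_of_deflations\<close>).

  (ET4) yields the objects \<open>B1\<close> and \<open>B2\<close> only up to isomorphism. To show that conflations are closed
  under isomorphism one would first need the long exact sequences of an extriangulated category.
  They are avoided as follows. Where the isomorphic object lies in \<open>T\<close>, it has the same class as
  the original. Where it does not, the isomorphism is itself a deflation with zero kernel, and
  (ET4)\<open>\<^sup>o\<^sup>p\<close> composes it with a presentation, changing the kernel only by an extension of a zero
  object (\<open>presentation_iso\<close>).
\<close>

section \<open>Grothendieck groups by generators and relations\<close>

locale grothendieck_group =
  fixes C :: "('o, 'm, 'e) extri"
  assumes conflation_Obj:
    "conflation C X x Y y Z \<Longrightarrow> X \<in> Obj C \<and> Y \<in> Obj C \<and> Z \<in> Obj C"
begin

abbreviation free_group :: "('o \<Rightarrow>\<^sub>0 int) monoid" where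
  "free_group \<equiv> free_Abelian_group (Obj C)"

lemma K0_relations_closed: "K0_relations C \<subseteq> carrier free_group"
proof
  fix r assume "r \<in> K0_relations C"
  then obtain X Y Z where r: "r = frag_of X - frag_of Y + frag_of Z"
    and "X \<in> Obj C" "Y \<in> Obj C" "Z \<in> Obj C"
    unfolding K0_relations_def using conflation_Obj by blast
  then have "frag_of X \<in> carrier free_group" "frag_of Z \<in> carrier free_group"
    "- frag_of Y \<in> carrier free_group"
    by simp_all
  then have "frag_of X \<otimes>\<^bsub>free_group\<^esub> - frag_of Y \<otimes>\<^bsub>free_group\<^esub> frag_of Z \<in> carrier free_group"
    using group.is_monoid[OF group_free_Abelian_group] monoid.m_closed by metis
  then show "r \<in> carrier free_group"
    by (simp only: mult_free_Abelian_group r diff_conv_add_uminus)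
qed

lemma K0_kernel_subgroup: "subgroup (K0_kernel C) free_group"
  unfolding K0_kernel_def
  by (rule group.generate_is_subgroup[OF group_free_Abelian_group K0_relations_closed])

lemma K0_kernel_normal: "K0_kernel C \<lhd> free_group"
  by (rule comm_group.subgroup_imp_normal[OF abelian_free_Abelian_group K0_kernel_subgroup])

lemma K0_comm_group: "comm_group (K0 C)"
  unfolding K0_def
  by (rule comm_group.abelian_FactGroup[OF abelian_free_Abelian_group K0_kernel_subgroup])

lemma coset_hom: "(\<lambda>c. K0_kernel C #>\<^bsub>free_group\<^esub> c) \<in> hom free_group (K0 C)"
  unfolding K0_def by (rule normal.r_coset_hom_Mod[OF K0_kernel_normal])

lemma K0_class_closed:
  assumes "X \<in> Obj C"
  shows "K0_class C X \<in> carrier (K0 C)"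
  unfolding K0_class_def by (rule hom_in_carrier[OF coset_hom]) (use assms in simp)

text \<open>
  The relation \<open>X - Y + Z\<close> becomes trivial in the quotient; adding \<open>Y\<close> to \<open>X - Y + Z\<close> in the
  free group turns this into a statement about sums only.
\<close>

lemma K0_class_conflation:
  assumes "conflation C X x Y y Z"
  shows "K0_class C Y = K0_class C X \<otimes>\<^bsub>K0 C\<^esub> K0_class C Z"
proof -
  let ?q = "\<lambda>c. K0_kernel C #>\<^bsub>free_group\<^esub> c"
  let ?r = "frag_of X - frag_of Y + frag_of Z"
  interpret K: comm_group "K0 C" by (rule K0_comm_group)
  have obj: "X \<in> Obj C" "Y \<in> Obj C" "Z \<in> Obj C"
    using conflation_Obj[OF assms] by auto
  have r: "?r \<in> K0_relations C"
    unfolding K0_relations_def using assms by blast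
  then have "?r \<in> K0_kernel C"
    unfolding K0_kernel_def by (rule generate.incl)
  then have "?q ?r = K0_kernel C"
    using K0_relations_closed r
    by (intro subgroup.rcos_const[OF K0_kernel_subgroup group_free_Abelian_group])
  then have one: "?q ?r = \<one>\<^bsub>K0 C\<^esub>"
    by (simp add: K0_def)
  have "?r + frag_of Y = frag_of X + frag_of Z"
    by simp
  moreover have "?q (?r \<otimes>\<^bsub>free_group\<^esub> frag_of Y) = ?q ?r \<otimes>\<^bsub>K0 C\<^esub> ?q (frag_of Y)"
    by (rule hom_mult[OF coset_hom subsetD[OF K0_relations_closed r]]) (use obj in simp)
  moreover have "?q (frag_of X \<otimes>\<^bsub>free_group\<^esub> frag_of Z) = ?q (frag_of X) \<otimes>\<^bsub>K0 C\<^esub> ?q (frag_of Z)"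
    using obj by (intro hom_mult[OF coset_hom]) auto
  ultimately show ?thesis
    using one K0_class_closed[OF obj(2)] by (simp add: K0_class_def)
qed

lemma K0_universal:
  fixes f :: "'o \<Rightarrow> 'a" and G :: "('a, 'b) monoid_scheme"
  assumes "comm_group G"
    and closed: "\<And>X. X \<in> Obj C \<Longrightarrow> f X \<in> carrier G"
    and additive: "\<And>X x Y y Z. conflation C X x Y y Z \<Longrightarrow> f Y = f X \<otimes>\<^bsub>G\<^esub> f Z"
  shows "\<exists>\<phi>\<in>hom (K0 C) G. \<forall>X\<in>Obj C. \<phi> (K0_class C X) = f X"
proof -
  interpret G: comm_group G by fact
  have "f ` Obj C \<subseteq> carrier G"
    using closed by blast
  then obtain h where h: "h \<in> hom free_group G" "\<And>X. X \<in> Obj C \<Longrightarrow> h (frag_of X) = f X"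
    using G.free_Abelian_group_universal[of f "Obj C"] by blast
  interpret h: group_hom free_group G h
    by (simp add: group_hom_def group_hom_axioms_def h G.is_group)
  have h_rel: "h r = \<one>\<^bsub>G\<^esub>" if "r \<in> K0_relations C" for r
  proof -
    obtain X Y Z x y where r: "r = frag_of X - frag_of Y + frag_of Z"
      and c: "conflation C X x Y y Z"
      using \<open>r \<in> K0_relations C\<close> unfolding K0_relations_def by blast
    have obj: "X \<in> Obj C" "Y \<in> Obj C" "Z \<in> Obj C"
      using conflation_Obj[OF c] by auto
    have "h r \<otimes>\<^bsub>G\<^esub> h (frag_of Y) = h (r \<otimes>\<^bsub>free_group\<^esub> frag_of Y)"
      by (rule h.hom_mult[symmetric, OF subsetD[OF K0_relations_closed that]]) (use obj in simp)
    also have "\<dots> = h (frag_of X \<otimes>\<^bsub>free_group\<^esub> frag_of Z)"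
      by (simp add: r)
    also have "\<dots> = f X \<otimes>\<^bsub>G\<^esub> f Z"
      using obj h by (subst h.hom_mult) auto
    also have "\<dots> = h (frag_of Y)"
      using additive[OF c] h obj by simp
    finally show ?thesis
      using h.hom_closed[OF subsetD[OF K0_relations_closed that]] obj closed h by simp
  qed
  have h_ker: "h k = \<one>\<^bsub>G\<^esub>" if "k \<in> K0_kernel C" for k
  proof -
    have "K0_relations C \<subseteq> kernel free_group G h"
      using h_rel K0_relations_closed unfolding kernel_def by blast
    then have "K0_kernel C \<subseteq> kernel free_group G h"
      unfolding K0_kernel_def
      by (rule group.generate_subgroup_incl[OF group_free_Abelian_group _ h.subgroup_kernel])
    with that show ?thesis
      unfolding kernel_def by blast
  qed
  have "h c = h c'"
    if "c \<in> carrier free_group" "c' \<in> carrier free_group"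
      "K0_kernel C #>\<^bsub>free_group\<^esub> c = K0_kernel C #>\<^bsub>free_group\<^esub> c'" for c c'
  proof -
    have "c \<in> K0_kernel C #>\<^bsub>free_group\<^esub> c'"
      using that group.rcos_self[OF group_free_Abelian_group] K0_kernel_subgroup by blast
    then obtain k where k: "k \<in> K0_kernel C" "c = k \<otimes>\<^bsub>free_group\<^esub> c'"
      unfolding r_coset_def by blast
    have "k \<in> carrier free_group"
      by (rule subgroup.mem_carrier[OF K0_kernel_subgroup k(1)])
    then show ?thesis
      using k that h_ker[OF k(1)] by (metis G.l_one h.hom_closed h.hom_mult)
  qed
  then obtain \<phi> where \<phi>: "\<phi> \<in> hom (free_group Mod K0_kernel C) G"
    "\<And>c. c \<in> carrier free_group \<Longrightarrow> \<phi> (K0_kernel C #>\<^bsub>free_group\<^esub> c) = h c"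
    using FactGroup_universal[OF h(1) K0_kernel_normal] by blast
  have "\<phi> \<in> hom (K0 C) G"
    unfolding K0_def by (rule \<phi>)
  moreover have "\<phi> (K0_class C X) = f X" if "X \<in> Obj C" for X
    using that h \<phi>(2)[of "frag_of X"] by (simp add: K0_class_def)
  ultimately show ?thesis
    by blast
qed

lemma K0_hom_eqI:
  fixes G :: "('a, 'b) monoid_scheme"
  assumes "group G" "\<phi> \<in> hom (K0 C) G" "\<psi> \<in> hom (K0 C) G"
    and eq: "\<And>X. X \<in> Obj C \<Longrightarrow> \<phi> (K0_class C X) = \<psi> (K0_class C X)"
    and "u \<in> carrier (K0 C)"
  shows "\<phi> u = \<psi> u"
proof -
  let ?q = "\<lambda>c. K0_kernel C #>\<^bsub>free_group\<^esub> c"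
  interpret p: group_hom free_group G "\<phi> \<circ> ?q"
    using hom_compose[OF coset_hom assms(2)] assms(1)
    by (simp add: group_hom_def group_hom_axioms_def)
  interpret s: group_hom free_group G "\<psi> \<circ> ?q"
    using hom_compose[OF coset_hom assms(3)] assms(1)
    by (simp add: group_hom_def group_hom_axioms_def)
  have diff: "a - b = a \<otimes>\<^bsub>free_group\<^esub> inv\<^bsub>free_group\<^esub> b" if "Poly_Mapping.keys b \<subseteq> Obj C" for a b
    using that by simp
  have "(\<phi> \<circ> ?q) c = (\<psi> \<circ> ?q) c" if "Poly_Mapping.keys c \<subseteq> Obj C" for c
    using that
  proof (rule free_Abelian_group_induct)
    show "(\<phi> \<circ> ?q) 0 = (\<psi> \<circ> ?q) 0"
      using p.hom_one s.hom_one by simp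
  next
    fix a b
    assume 2: "Poly_Mapping.keys a \<subseteq> Obj C" "Poly_Mapping.keys b \<subseteq> Obj C"
      "(\<phi> \<circ> ?q) a = (\<psi> \<circ> ?q) a" "(\<phi> \<circ> ?q) b = (\<psi> \<circ> ?q) b"
    have c: "a \<in> carrier free_group" "b \<in> carrier free_group"
      "inv\<^bsub>free_group\<^esub> b \<in> carrier free_group"
      using 2 by auto
    show "(\<phi> \<circ> ?q) (a - b) = (\<psi> \<circ> ?q) (a - b)"
      unfolding diff[OF 2(2)] p.hom_mult[OF c(1,3)] s.hom_mult[OF c(1,3)]
        p.hom_inv[OF c(2)] s.hom_inv[OF c(2)] 2(3) 2(4) ..
  next
    fix X
    assume "X \<in> Obj C"
    then show "(\<phi> \<circ> ?q) (frag_of X) = (\<psi> \<circ> ?q) (frag_of X)"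
      using eq by (simp add: K0_class_def)
  qed
  moreover obtain c where "c \<in> carrier free_group" "u = ?q c"
    using assms(5) by (auto simp: K0_def carrier_FactGroup)
  ultimately show ?thesis
    by simp
qed

end

section \<open>Biproducts and zero objects in an additive category\<close>

context additive_category
begin

lemma Hom_group: "\<lbrakk>X \<in> Obj C; Y \<in> Obj C\<rbrakk> \<Longrightarrow> group (Hom C X Y)"
  using Hom_comm_group comm_group.axioms(2) by blast

lemma zero_arrow_closed:
  "\<lbrakk>X \<in> Obj C; Y \<in> Obj C\<rbrakk> \<Longrightarrow> \<one>\<^bsub>Hom C X Y\<^esub> \<in> carrier (Hom C X Y)"
  using Hom_group group.is_monoid monoid.one_closed by blast

lemma add_arrow_closed:
  "\<lbrakk>X \<in> Obj C; Y \<in> Obj C; f \<in> carrier (Hom C X Y); f' \<in> carrier (Hom C X Y)\<rbrakk>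
    \<Longrightarrow> f \<otimes>\<^bsub>Hom C X Y\<^esub> f' \<in> carrier (Hom C X Y)"
  using Hom_group group.is_monoid monoid.m_closed by metis

lemma Cmp_zero_right:
  assumes "X \<in> Obj C" "Y \<in> Obj C" "Z \<in> Obj C" "g \<in> carrier (Hom C Y Z)"
  shows "g \<cdot> \<one>\<^bsub>Hom C X Y\<^esub> = \<one>\<^bsub>Hom C X Z\<^esub>"
proof (rule hom_one)
  show "(\<cdot>) g \<in> hom (Hom C X Y) (Hom C X Z)"
    using assms by (intro homI) (auto simp: Cmp_closed Cmp_add_right)
qed (use assms in \<open>auto simp: Hom_group\<close>)

lemma Cmp_zero_left:
  assumes "X \<in> Obj C" "Y \<in> Obj C" "Z \<in> Obj C" "f \<in> carrier (Hom C X Y)"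
  shows "\<one>\<^bsub>Hom C Y Z\<^esub> \<cdot> f = \<one>\<^bsub>Hom C X Z\<^esub>"
proof (rule hom_one[where h = "\<lambda>g. g \<cdot> f"])
  show "(\<lambda>g. g \<cdot> f) \<in> hom (Hom C Y Z) (Hom C X Z)"
    using assms by (intro homI) (auto simp: Cmp_closed Cmp_add_left)
qed (use assms in \<open>auto simp: Hom_group\<close>)

lemma Idt_iso_arrow: "X \<in> Obj C \<Longrightarrow> iso_arrow C X X (Idt C X)"
  unfolding iso_arrow_def using Idt_closed Cmp_Idt_left by blast

lemma iso_arrow_sym:
  assumes "iso_arrow C X Y f"
  obtains g where "iso_arrow C Y X g" "g \<cdot> f = Idt C X" "f \<cdot> g = Idt C Y"
  using assms unfolding iso_arrow_def by blast

lemma iso_arrow_Cmp: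
  assumes "X \<in> Obj C" "Y \<in> Obj C" "Z \<in> Obj C" "iso_arrow C X Y f" "iso_arrow C Y Z g"
  shows "iso_arrow C X Z (g \<cdot> f)"
proof -
  obtain f' g' where a: "f \<in> carrier (Hom C X Y)" "f' \<in> carrier (Hom C Y X)"
      "g \<in> carrier (Hom C Y Z)" "g' \<in> carrier (Hom C Z Y)"
    and eq: "f' \<cdot> f = Idt C X" "f \<cdot> f' = Idt C Y" "g' \<cdot> g = Idt C Y" "g \<cdot> g' = Idt C Z"
    using assms(4,5) unfolding iso_arrow_def by blast
  have gf: "g \<cdot> f \<in> carrier (Hom C X Z)" and fg: "f' \<cdot> g' \<in> carrier (Hom C Z X)"
    using Cmp_closed a assms(1-3) by blast+
  have "(f' \<cdot> g') \<cdot> (g \<cdot> f) = f' \<cdot> ((g' \<cdot> g) \<cdot> f)"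
    using Cmp_assoc[OF assms(1,3,2,1) gf a(4,2)] Cmp_assoc[OF assms(1,2,3,2) a(1,3,4)] by simp
  moreover have "(g \<cdot> f) \<cdot> (f' \<cdot> g') = g \<cdot> ((f \<cdot> f') \<cdot> g')"
    using Cmp_assoc[OF assms(3,1,2,3) fg a(1,3)] Cmp_assoc[OF assms(3,2,1,2) a(4,2,1)] by simp
  ultimately show ?thesis
    unfolding iso_arrow_def using gf fg eq a assms(1-3) by (auto simp: Cmp_Idt_left)
qed

lemma biproduct_swap:
  assumes "biproduct C A B S i j p q"
  shows "biproduct C B A S j i q p"
proof -
  have obj: "A \<in> Obj C" "B \<in> Obj C" "S \<in> Obj C"
    and arr: "i \<in> carrier (Hom C A S)" "j \<in> carrier (Hom C B S)"
      "p \<in> carrier (Hom C S A)" "q \<in> carrier (Hom C S B)"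
    using assms unfolding biproduct_def by auto
  interpret S: comm_group "Hom C S S"
    using obj by (simp add: Hom_comm_group)
  have "(j \<cdot> q) \<otimes>\<^bsub>Hom C S S\<^esub> (i \<cdot> p) = (i \<cdot> p) \<otimes>\<^bsub>Hom C S S\<^esub> (j \<cdot> q)"
    using Cmp_closed obj arr by (intro S.m_comm) auto
  then show ?thesis
    using assms unfolding biproduct_def by simp
qed

lemma biproduct_iso:
  assumes "biproduct C A B S i j p q" and S': "S' \<in> Obj C" and "iso_arrow C S S' g"
  obtains i' j' p' q' where "biproduct C A B S' i' j' p' q'"
proof -
  have obj: "A \<in> Obj C" "B \<in> Obj C" "S \<in> Obj C"
    and arr: "i \<in> carrier (Hom C A S)" "j \<in> carrier (Hom C B S)"
      "p \<in> carrier (Hom C S A)" "q \<in> carrier (Hom C S B)"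
    and eq: "p \<cdot> i = Idt C A" "q \<cdot> j = Idt C B"
      "q \<cdot> i = \<one>\<^bsub>Hom C A B\<^esub>" "p \<cdot> j = \<one>\<^bsub>Hom C B A\<^esub>"
    and sum: "(i \<cdot> p) \<otimes>\<^bsub>Hom C S S\<^esub> (j \<cdot> q) = Idt C S"
    using assms(1) unfolding biproduct_def by auto
  obtain g' where g: "g \<in> carrier (Hom C S S')" and g': "g' \<in> carrier (Hom C S' S)"
    and inv: "g' \<cdot> g = Idt C S" "g \<cdot> g' = Idt C S'"
    using assms(3) unfolding iso_arrow_def by blast
  have cancel: "g' \<cdot> (g \<cdot> f) = f" if "W \<in> Obj C" "f \<in> carrier (Hom C W S)" for W f
    using Cmp_assoc[OF that(1) obj(3) S' obj(3) that(2) g g'] inv(1) Cmp_Idt_left[OF that(1) obj(3) that(2)]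
    by simp
  have inner: "(r \<cdot> g') \<cdot> (g \<cdot> f) = r \<cdot> f"
    if "W \<in> Obj C" "V \<in> Obj C" "f \<in> carrier (Hom C W S)" "r \<in> carrier (Hom C S V)" for W V f r
    using Cmp_assoc[OF that(1) S' obj(3) that(2) _ g' that(4), of "g \<cdot> f"]
      Cmp_closed[OF that(1) obj(3) S' that(3) g] cancel[OF that(1,3)] by simp
  have outer: "(g \<cdot> f) \<cdot> (r \<cdot> g') = g \<cdot> (f \<cdot> r) \<cdot> g'"
    if "W \<in> Obj C" "f \<in> carrier (Hom C W S)" "r \<in> carrier (Hom C S W)" for W f r
  proof -
    have "(g \<cdot> f) \<cdot> (r \<cdot> g') = ((g \<cdot> f) \<cdot> r) \<cdot> g'"
      using Cmp_assoc[OF S' obj(3) that(1) S' g' that(3) Cmp_closed[OF that(1) obj(3) S' that(2) g]]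
      by simp
    also have "(g \<cdot> f) \<cdot> r = g \<cdot> (f \<cdot> r)"
      by (rule Cmp_assoc[OF obj(3) that(1) obj(3) S' that(3,2) g])
    finally show ?thesis .
  qed
  have ip: "i \<cdot> p \<in> carrier (Hom C S S)" and jq: "j \<cdot> q \<in> carrier (Hom C S S)"
    using Cmp_closed obj arr by blast+
  have "(g \<cdot> (i \<cdot> p) \<cdot> g') \<otimes>\<^bsub>Hom C S' S'\<^esub> (g \<cdot> (j \<cdot> q) \<cdot> g')
      = (g \<cdot> (i \<cdot> p) \<otimes>\<^bsub>Hom C S S'\<^esub> g \<cdot> (j \<cdot> q)) \<cdot> g'"
    by (rule Cmp_add_left[symmetric, OF S' obj(3) S' g' Cmp_closed[OF obj(3) obj(3) S' ip g]
          Cmp_closed[OF obj(3) obj(3) S' jq g]])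
  also have "g \<cdot> (i \<cdot> p) \<otimes>\<^bsub>Hom C S S'\<^esub> g \<cdot> (j \<cdot> q) = g \<cdot> Idt C S"
    using Cmp_add_right[OF obj(3) obj(3) S' ip jq g] sum by simp
  also have "g \<cdot> Idt C S \<cdot> g' = Idt C S'"
    using inv Cmp_Idt_right[OF obj(3) S' g] by simp
  finally have "biproduct C A B S' (g \<cdot> i) (g \<cdot> j) (p \<cdot> g') (q \<cdot> g')"
    unfolding biproduct_def using obj S' arr g g' eq
    by (auto simp: inner outer intro: Cmp_closed)
  then show thesis
    by (rule that)
qed

lemma iso_biproduct_zero:
  assumes "A \<in> Obj C" "B \<in> Obj C" "zero_object C N" "iso_arrow C A B f"
    "f' \<in> carrier (Hom C B A)" "f' \<cdot> f = Idt C A" "f \<cdot> f' = Idt C B"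
  shows "biproduct C A N B f \<one>\<^bsub>Hom C N B\<^esub> f' \<one>\<^bsub>Hom C B N\<^esub>"
proof -
  have obj: "A \<in> Obj C" "B \<in> Obj C" "N \<in> Obj C"
    using assms unfolding zero_object_def by auto
  have f: "f \<in> carrier (Hom C A B)"
    using assms(4) unfolding iso_arrow_def by blast
  have "carrier (Hom C N N) = {\<one>\<^bsub>Hom C N N\<^esub>}"
    using assms(3) unfolding zero_object_def trivial_group_def by blast
  then have idN: "Idt C N = \<one>\<^bsub>Hom C N N\<^esub>"
    using Idt_closed[OF obj(3)] by blast
  interpret B: comm_group "Hom C B B"
    using obj by (simp add: Hom_comm_group)
  show ?thesis
    unfolding biproduct_def
    using assms(5-7) obj f zero_arrow_closed[of N B] zero_arrow_closed[of B N] Idt_closed[of B]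
    by (auto simp: idN Cmp_zero_left Cmp_zero_right)
qed

end

section \<open>Conflations in an extriangulated category\<close>

lemma realizes_opp: "realizes (opp C) Z X \<delta> y Y x \<longleftrightarrow> realizes C X Z \<delta> x Y y"
  by (auto simp: realizes_def opp_def)

context extriangulated_category
begin

lemma seq_equiv_equiv:
  assumes "X \<in> Obj C" "Z \<in> Obj C"
  shows "equiv (sequences C X Z) (seq_equiv C X Z)"
proof (rule equivI)
  show "seq_equiv C X Z \<subseteq> sequences C X Z \<times> sequences C X Z"
    unfolding seq_equiv_def by auto
  show "refl_on (sequences C X Z) (seq_equiv C X Z)"
  proof (rule refl_onI)
    fix s assume s: "s \<in> sequences C X Z"
    then obtain x Y y where "s = (x, Y, y)" "Y \<in> Obj C"
      "x \<in> carrier (Hom C X Y)" "y \<in> carrier (Hom C Y Z)"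
      unfolding sequences_def by blast
    then show "(s, s) \<in> seq_equiv C X Z"
      using s assms Idt_iso_arrow[of Y] Cmp_Idt_left[of X Y x] Cmp_Idt_right[of Y Z y]
      unfolding seq_equiv_def by auto
  qed
  show "sym (seq_equiv C X Z)"
  proof (rule symI)
    fix s t assume st: "(s, t) \<in> seq_equiv C X Z"
    obtain x Y y x' Y' y' g where s: "s = (x, Y, y)" and t: "t = (x', Y', y')"
      and seq: "s \<in> sequences C X Z" "t \<in> sequences C X Z"
      and iso: "iso_arrow C Y Y' g" and eq: "g \<cdot> x = x'" "y' \<cdot> g = y"
      using st unfolding seq_equiv_def by blast
    obtain g' where g': "iso_arrow C Y' Y g'" and inv: "g' \<cdot> g = Idt C Y" "g \<cdot> g' = Idt C Y'"
      using iso by (rule iso_arrow_sym)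
    have arr: "Y \<in> Obj C" "Y' \<in> Obj C" "x \<in> carrier (Hom C X Y)" "y' \<in> carrier (Hom C Y' Z)"
      "g \<in> carrier (Hom C Y Y')" "g' \<in> carrier (Hom C Y' Y)"
      using seq iso g' unfolding s t sequences_def iso_arrow_def by auto
    have "g' \<cdot> (g \<cdot> x) = (g' \<cdot> g) \<cdot> x"
      by (rule Cmp_assoc[symmetric]) (use arr assms in auto)
    then have "g' \<cdot> x' = x"
      using arr assms eq(1) inv(1) Cmp_Idt_left[of X Y x] by simp
    moreover have "(y' \<cdot> g) \<cdot> g' = y' \<cdot> (g \<cdot> g')"
      by (rule Cmp_assoc) (use arr assms in auto)
    then have "y \<cdot> g' = y'"
      using arr assms eq(2) inv(2) Cmp_Idt_right[of Y' Z y'] by simp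
    ultimately show "(t, s) \<in> seq_equiv C X Z"
      using seq g' unfolding s t seq_equiv_def by auto
  qed
  show "trans (seq_equiv C X Z)"
  proof (rule transI)
    fix s t u assume st: "(s, t) \<in> seq_equiv C X Z" and tu: "(t, u) \<in> seq_equiv C X Z"
    obtain x Y y x' Y' y' g where s: "s = (x, Y, y)" and t: "t = (x', Y', y')"
      and seq: "s \<in> sequences C X Z" "t \<in> sequences C X Z"
      and g: "iso_arrow C Y Y' g" and eq: "g \<cdot> x = x'" "y' \<cdot> g = y"
      using st unfolding seq_equiv_def by blast
    obtain x'' Y'' y'' h where u: "u = (x'', Y'', y'')" and seq': "u \<in> sequences C X Z"
      and h: "iso_arrow C Y' Y'' h" and eq': "h \<cdot> x' = x''" "y'' \<cdot> h = y'"
      using tu unfolding t seq_equiv_def by blast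
    have arr: "Y \<in> Obj C" "Y' \<in> Obj C" "Y'' \<in> Obj C" "x \<in> carrier (Hom C X Y)"
      "y'' \<in> carrier (Hom C Y'' Z)" "g \<in> carrier (Hom C Y Y')" "h \<in> carrier (Hom C Y' Y'')"
      using seq seq' g h unfolding s t u sequences_def iso_arrow_def by auto
    have "(h \<cdot> g) \<cdot> x = x''"
      using Cmp_assoc[OF assms(1) arr(1-3,4,6,7)] eq eq' by simp
    moreover have "y'' \<cdot> (h \<cdot> g) = y"
      using Cmp_assoc[OF arr(1-3) assms(2) arr(6,7,5)] eq eq' by simp
    moreover have "iso_arrow C Y Y'' (h \<cdot> g)"
      using arr g h by (intro iso_arrow_Cmp) auto
    ultimately show "(s, u) \<in> seq_equiv C X Z"
      using seq seq' unfolding s u seq_equiv_def by auto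
  qed
qed

lemma realizes_closed:
  assumes "realizes C Z X \<delta> x Y y"
  shows "X \<in> Obj C" "Y \<in> Obj C" "Z \<in> Obj C" "\<delta> \<in> carrier (Ext C Z X)"
    "x \<in> carrier (Hom C X Y)" "y \<in> carrier (Hom C Y Z)"
proof -
  show *: "X \<in> Obj C" "Z \<in> Obj C" "\<delta> \<in> carrier (Ext C Z X)"
    using assms unfolding realizes_def by auto
  have "Rlz C Z X \<delta> \<subseteq> sequences C X Z"
    by (rule in_quotient_imp_subset[OF seq_equiv_equiv[OF *(1,2)] Rlz_class[OF *(2,1,3)]])
  then have "(x, Y, y) \<in> sequences C X Z"
    using assms unfolding realizes_def by blast
  then show "Y \<in> Obj C" "x \<in> carrier (Hom C X Y)" "y \<in> carrier (Hom C Y Z)"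
    unfolding sequences_def by auto
qed

lemma conflation_closed:
  assumes "conflation C X x Y y Z"
  shows "X \<in> Obj C" "Y \<in> Obj C" "Z \<in> Obj C"
  using assms realizes_closed unfolding conflation_def by blast+

lemma realizes_unique:
  assumes "realizes C Z X \<delta> x Y y" "realizes C Z X \<delta> x' Y' y'"
  obtains g where "iso_arrow C Y Y' g"
proof -
  note c = realizes_closed[OF assms(1)]
  have "{(x, Y, y), (x', Y', y')} \<subseteq> Rlz C Z X \<delta>"
    using assms unfolding realizes_def by auto
  then have "((x, Y, y), (x', Y', y')) \<in> seq_equiv C X Z"
    by (rule in_quotient_imp_in_rel[OF seq_equiv_equiv[OF c(1,3)] Rlz_class[OF c(3,1,4)]])
  then show thesis
    using that unfolding seq_equiv_def by auto
qed

lemma ex_realization: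
  assumes "X \<in> Obj C" "Z \<in> Obj C" "\<delta> \<in> carrier (Ext C Z X)"
  obtains x Y y where "realizes C Z X \<delta> x Y y"
proof -
  have "Rlz C Z X \<delta> \<noteq> {}"
    by (rule in_quotient_imp_non_empty[OF seq_equiv_equiv Rlz_class]) (use assms in auto)
  then show thesis
    using that assms unfolding realizes_def by fast
qed

lemma Ext_group: "\<lbrakk>Z \<in> Obj C; X \<in> Obj C\<rbrakk> \<Longrightarrow> group (Ext C Z X)"
  using Ext_comm_group comm_group.axioms(2) by blast

lemma Ext_one_closed:
  "\<lbrakk>Z \<in> Obj C; X \<in> Obj C\<rbrakk> \<Longrightarrow> \<one>\<^bsub>Ext C Z X\<^esub> \<in> carrier (Ext C Z X)"
  using Ext_group group.is_monoid monoid.one_closed by blast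

lemma biproduct_realizes:
  assumes "biproduct C X Z S i j p q"
  shows "realizes C Z X \<one>\<^bsub>Ext C Z X\<^esub> i S q"
proof -
  have o: "X \<in> Obj C" "Z \<in> Obj C" and s: "(i, S, q) \<in> sequences C X Z"
    using assms unfolding biproduct_def sequences_def by auto
  have "(i, S, q) \<in> Rlz C Z X \<one>\<^bsub>Ext C Z X\<^esub>"
    unfolding Rlz_zero[OF assms] by (rule equiv_class_self[OF seq_equiv_equiv[OF o] s])
  then show ?thesis
    using o Ext_one_closed unfolding realizes_def by blast
qed

text \<open>
  The zero extension of \<open>B\<close> by a zero object is realized by every object isomorphic to \<open>B\<close>.
\<close>

lemma iso_is_deflation:
  assumes "A \<in> Obj C" "B \<in> Obj C" "iso_arrow C A B f" "zero_object C N"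
  obtains x where "conflation C N x A f B"
proof -
  obtain g where g: "iso_arrow C B A g" "g \<cdot> f = Idt C A" "f \<cdot> g = Idt C B"
    using assms(3) by (rule iso_arrow_sym)
  have arr: "f \<in> carrier (Hom C A B)" "g \<in> carrier (Hom C B A)"
    using assms(3) g(1) unfolding iso_arrow_def by auto
  have "biproduct C N B A \<one>\<^bsub>Hom C N A\<^esub> g \<one>\<^bsub>Hom C A N\<^esub> f"
    by (rule biproduct_swap[OF iso_biproduct_zero[OF assms(2,1,4) g(1) arr(1) g(3,2)]])
  then show thesis
    using that biproduct_realizes unfolding conflation_def by blast
qed

lemma inflations_compose:
  assumes "realizes C Z' X \<delta> f Y f'" "realizes C X' Y \<delta>' g Z g'"
  obtains Y' h' d e where "conflation C X (g \<cdot> f) Z h' Y'" "realizes C X' Z' (Push C f' \<delta>') d Y' e"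
proof -
  from ET4[unfolded ET4_def, rule_format, OF conjI[OF assms]]
  obtain Y' h' d e \<delta>'' where "realizes C Y' X \<delta>'' (g \<cdot> f) Z h'"
    "realizes C X' Z' (Push C f' \<delta>') d Y' e"
    by (elim exE conjE)
  then show thesis
    using that unfolding conflation_def by metis
qed

text \<open>
  The kernel of a composite deflation is an extension of the two kernels; this is the part of
  (ET4)\<open>\<^sup>o\<^sup>p\<close> that replaces the snake lemma.
\<close>

lemma deflations_compose:
  assumes "conflation C A u B v D" "conflation C E w F z B"
  obtains K h d e where "conflation C K h F (v \<cdot> z) D" "conflation C E e K d A"
proof -
  obtain \<delta> \<delta>' where "realizes C D A \<delta> u B v" "realizes C B E \<delta>' w F z"
    using assms unfolding conflation_def by blast
  then have "realizes (opp C) A D \<delta> v B u" "realizes (opp C) E B \<delta>' z F w"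
    by (simp_all add: realizes_opp)
  from ET4_op[unfolded ET4_def, rule_format, OF conjI[OF this]]
  obtain K h d e \<delta>'' where "realizes C D K \<delta>'' h F (z \<cdot>\<^bsub>opp C\<^esub> v)"
      "realizes C A E (Push (opp C) u \<delta>') e K d"
    unfolding realizes_opp by blast
  moreover have "z \<cdot>\<^bsub>opp C\<^esub> v = v \<cdot> z"
    by (simp add: opp_def)
  ultimately show thesis
    using that unfolding conflation_def by metis
qed

lemma Push_closed:
  "\<lbrakk>Z \<in> Obj C; X \<in> Obj C; X' \<in> Obj C; f \<in> carrier (Hom C X X'); \<delta> \<in> carrier (Ext C Z X)\<rbrakk>
    \<Longrightarrow> Push C f \<delta> \<in> carrier (Ext C Z X')"
  by (rule hom_in_carrier[OF Push_hom])

lemma Pull_closed: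
  "\<lbrakk>Z \<in> Obj C; Z' \<in> Obj C; X \<in> Obj C; h \<in> carrier (Hom C Z' Z); \<delta> \<in> carrier (Ext C Z X)\<rbrakk>
    \<Longrightarrow> Pull C h \<delta> \<in> carrier (Ext C Z' X)"
  by (rule hom_in_carrier[OF Pull_hom])

lemma Push_zero:
  assumes "Z \<in> Obj C" "X \<in> Obj C" "X' \<in> Obj C" "\<delta> \<in> carrier (Ext C Z X)"
  shows "Push C \<one>\<^bsub>Hom C X X'\<^esub> \<delta> = \<one>\<^bsub>Ext C Z X'\<^esub>"
proof (rule hom_one[where h = "\<lambda>f. Push C f \<delta>"])
  show "(\<lambda>f. Push C f \<delta>) \<in> hom (Hom C X X') (Ext C Z X')"
    using assms by (intro homI) (auto simp: Push_closed Push_add)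
qed (use assms in \<open>auto simp: Hom_group Ext_group\<close>)

text \<open>
  Over a realization of \<open>\<nu>\<close> by \<open>M\<close>, dividing \<open>M\<close> by one summand of the kernel \<open>A\<^sub>1 \<oplus> A\<^sub>2\<close> realizes
  the component of \<open>\<nu>\<close> at the other summand: this is (ET4) for the split inflation
  \<open>A\<^sub>2 \<rightarrow> A\<^sub>1 \<oplus> A\<^sub>2\<close>.
\<close>

lemma quotient_by_summand:
  assumes "biproduct C A1 A2 S i1 i2 p1 p2" "realizes C Z S \<nu> m M e"
    "realizes C Z A1 (Push C p1 \<nu>) x B y"
  obtains w z B' g where "conflation C A2 w M z B'" "iso_arrow C B' B g"
proof -
  have "realizes C A1 A2 \<one>\<^bsub>Ext C A1 A2\<^esub> i2 S p1"
    by (rule biproduct_realizes[OF biproduct_swap[OF assms(1)]])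
  then obtain B' h' d e' where "conflation C A2 (m \<cdot> i2) M h' B'"
    "realizes C Z A1 (Push C p1 \<nu>) d B' e'"
    using inflations_compose[OF _ assms(2)] by metis
  then show thesis
    using realizes_unique[OF _ assms(3)] that by metis
qed

text \<open>
  The pullback of two deflations onto \<open>Z\<close>, up to isomorphism of its quotients. It is a realization
  of \<open>i\<^sub>1\<^sub>*\<delta>\<^sub>1 + i\<^sub>2\<^sub>*\<delta>\<^sub>2 \<in> \<bbbE>(Z, A\<^sub>1 \<oplus> A\<^sub>2)\<close>, the extension with components \<open>\<delta>\<^sub>1\<close> and \<open>\<delta>\<^sub>2\<close>.
\<close>

lemma pullback_of_deflations:
  assumes "conflation C A1 x1 B1 y1 Z" "conflation C A2 x2 B2 y2 Z"
  obtains M w1 z1 B1' g1 w2 z2 B2' g2 where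
    "conflation C A2 w1 M z1 B1'" "iso_arrow C B1' B1 g1"
    "conflation C A1 w2 M z2 B2'" "iso_arrow C B2' B2 g2"
proof -
  obtain \<delta>1 \<delta>2 where r1: "realizes C Z A1 \<delta>1 x1 B1 y1" and r2: "realizes C Z A2 \<delta>2 x2 B2 y2"
    using assms unfolding conflation_def by blast
  have obj: "A1 \<in> Obj C" "A2 \<in> Obj C" "Z \<in> Obj C"
    and ext: "\<delta>1 \<in> carrier (Ext C Z A1)" "\<delta>2 \<in> carrier (Ext C Z A2)"
    using realizes_closed[OF r1] realizes_closed[OF r2] by auto
  obtain S i1 i2 p1 p2 where bp: "biproduct C A1 A2 S i1 i2 p1 p2"
    using ex_biproduct obj by blast
  have S: "S \<in> Obj C" and arr: "i1 \<in> carrier (Hom C A1 S)" "i2 \<in> carrier (Hom C A2 S)"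
      "p1 \<in> carrier (Hom C S A1)" "p2 \<in> carrier (Hom C S A2)"
    and eq: "p1 \<cdot> i1 = Idt C A1" "p2 \<cdot> i2 = Idt C A2"
      "p2 \<cdot> i1 = \<one>\<^bsub>Hom C A1 A2\<^esub>" "p1 \<cdot> i2 = \<one>\<^bsub>Hom C A2 A1\<^esub>"
    using bp unfolding biproduct_def by auto
  interpret S: comm_group "Ext C Z S" using Ext_comm_group obj S by blast
  interpret E1: comm_group "Ext C Z A1" using Ext_comm_group obj by blast
  interpret E2: comm_group "Ext C Z A2" using Ext_comm_group obj by blast
  have i: "Push C i1 \<delta>1 \<in> carrier (Ext C Z S)" "Push C i2 \<delta>2 \<in> carrier (Ext C Z S)"
    using Push_closed obj S arr ext by blast+
  define \<nu> where "\<nu> = Push C i1 \<delta>1 \<otimes>\<^bsub>Ext C Z S\<^esub> Push C i2 \<delta>2"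
  have \<nu>: "\<nu> \<in> carrier (Ext C Z S)"
    unfolding \<nu>_def using i by (rule S.m_closed)
  have c1: "Push C p1 \<nu> = \<delta>1"
    unfolding \<nu>_def
    using hom_mult[OF Push_hom[OF obj(3) S obj(1) arr(3)] i] obj S arr ext
      Push_Cmp[symmetric, OF obj(3,1) S obj(1) ext(1) arr(1,3)] Push_Cmp[symmetric, OF obj(3,2) S obj(1) ext(2) arr(2,3)]
    by (simp add: eq Push_Idt Push_zero)
  have c2: "Push C p2 \<nu> = \<delta>2"
    unfolding \<nu>_def
    using hom_mult[OF Push_hom[OF obj(3) S obj(2) arr(4)] i] obj S arr ext
      Push_Cmp[symmetric, OF obj(3,1) S obj(2) ext(1) arr(1,4)] Push_Cmp[symmetric, OF obj(3,2) S obj(2) ext(2) arr(2,4)]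
    by (simp add: eq Push_Idt Push_zero)
  obtain m M e where \<nu>r: "realizes C Z S \<nu> m M e"
    using ex_realization[OF S obj(3) \<nu>] by blast
  obtain w1 z1 B1' g1 where "conflation C A2 w1 M z1 B1'" "iso_arrow C B1' B1 g1"
    using quotient_by_summand[OF bp \<nu>r, unfolded c1, OF r1] by blast
  moreover obtain w2 z2 B2' g2 where "conflation C A1 w2 M z2 B2'" "iso_arrow C B2' B2 g2"
    using quotient_by_summand[OF biproduct_swap[OF bp] \<nu>r, unfolded c2, OF r2] by blast
  ultimately show thesis
    by (rule that)
qed

lemma arrow_sum_closed:
  assumes "biproduct C A A' SA iA iA' pA pA'" "biproduct C B B' SB iB iB' pB pB'"
    "f \<in> carrier (Hom C A B)" "f' \<in> carrier (Hom C A' B')"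
  shows "arrow_sum C SA SB pA pA' iB iB' f f' \<in> carrier (Hom C SA SB)"
proof -
  have o: "A \<in> Obj C" "A' \<in> Obj C" "SA \<in> Obj C" "B \<in> Obj C" "B' \<in> Obj C" "SB \<in> Obj C"
    and a: "pA \<in> carrier (Hom C SA A)" "pA' \<in> carrier (Hom C SA A')"
      "iB \<in> carrier (Hom C B SB)" "iB' \<in> carrier (Hom C B' SB)"
    using assms(1,2) unfolding biproduct_def by auto
  show ?thesis
    unfolding arrow_sum_def
    by (rule add_arrow_closed[OF o(3,6)
          Cmp_closed[OF o(3,1,6) a(1) Cmp_closed[OF o(1,4,6) assms(3) a(3)]]
          Cmp_closed[OF o(3,2,6) a(2) Cmp_closed[OF o(2,5,6) assms(4) a(4)]]])
qed

lemma ext_sum_closed: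
  assumes "biproduct C X X' SX iX iX' pX pX'" "biproduct C Z Z' SZ iZ iZ' pZ pZ'"
    "\<delta> \<in> carrier (Ext C Z X)" "\<delta>' \<in> carrier (Ext C Z' X')"
  shows "ext_sum C SZ SX iX iX' pZ pZ' \<delta> \<delta>' \<in> carrier (Ext C SZ SX)"
proof -
  have o: "X \<in> Obj C" "X' \<in> Obj C" "SX \<in> Obj C" "Z \<in> Obj C" "Z' \<in> Obj C" "SZ \<in> Obj C"
    and a: "iX \<in> carrier (Hom C X SX)" "iX' \<in> carrier (Hom C X' SX)"
      "pZ \<in> carrier (Hom C SZ Z)" "pZ' \<in> carrier (Hom C SZ Z')"
    using assms(1,2) unfolding biproduct_def by auto
  interpret E: comm_group "Ext C SZ SX" using Ext_comm_group o by blast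
  show ?thesis
    unfolding ext_sum_def
    by (rule E.m_closed[OF
          Push_closed[OF o(6,1,3) a(1) Pull_closed[OF o(4,6,1) a(3) assms(3)]]
          Push_closed[OF o(6,2,3) a(2) Pull_closed[OF o(5,6,2) a(4) assms(4)]]])
qed

lemma conflation_sum:
  assumes "conflation C X x Y y Z" "conflation C X' x' Y' y' Z'"
    and bX: "biproduct C X X' SX iX iX' pX pX'"
    and bY: "biproduct C Y Y' SY iY iY' pY pY'"
    and bZ: "biproduct C Z Z' SZ iZ iZ' pZ pZ'"
  obtains s t where "conflation C SX s SY t SZ"
proof -
  obtain \<delta> \<delta>' where r: "realizes C Z X \<delta> x Y y" "realizes C Z' X' \<delta>' x' Y' y'"
    using assms(1,2) unfolding conflation_def by blast
  note c = realizes_closed[OF r(1)] and c' = realizes_closed[OF r(2)]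
  let ?s = "(arrow_sum C SX SY pX pX' iY iY' x x', SY, arrow_sum C SY SZ pY pY' iZ iZ' y y')"
  have o: "SX \<in> Obj C" "SZ \<in> Obj C" "SY \<in> Obj C"
    using bX bY bZ unfolding biproduct_def by auto
  have "?s \<in> sequences C SX SZ"
    unfolding sequences_def
    using arrow_sum_closed[OF bX bY c(5) c'(5)] arrow_sum_closed[OF bY bZ c(6) c'(6)] o by auto
  then have "?s \<in> Rlz C SZ SX (ext_sum C SZ SX iX iX' pZ pZ' \<delta> \<delta>')"
    unfolding Rlz_sum[OF r bX bY bZ] by (rule equiv_class_self[OF seq_equiv_equiv[OF o(1,2)]])
  then have "realizes C SZ SX (ext_sum C SZ SX iX iX' pZ pZ' \<delta> \<delta>')
      (arrow_sum C SX SY pX pX' iY iY' x x') SY (arrow_sum C SY SZ pY pY' iZ iZ' y y')"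
    unfolding realizes_def using o ext_sum_closed[OF bX bZ c(4) c'(4)] by blast
  then show thesis
    using that unfolding conflation_def by blast
qed

text \<open>
  Adding an object \<open>Q\<close> to the middle and the end of a conflation: the direct sum with
  \<open>0 \<rightarrow> Q \<rightarrow> Q\<close>.
\<close>

lemma conflation_add_object:
  assumes "conflation C A x B y X" "biproduct C B Q F iB iQ pB pQ" "biproduct C X Q M i j p q"
  obtains s t where "conflation C A s F t M"
proof -
  obtain N where N: "zero_object C N"
    using ex_zero_object by blast
  have obj: "A \<in> Obj C" "Q \<in> Obj C" "N \<in> Obj C"
    using conflation_closed[OF assms(1)] assms(2) N unfolding biproduct_def zero_object_def by auto
  obtain x' where Q: "conflation C N x' Q (Idt C Q) Q"
    using iso_is_deflation[OF obj(2,2) Idt_iso_arrow[OF obj(2)] N] by blast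
  have "biproduct C A N A (Idt C A) \<one>\<^bsub>Hom C N A\<^esub> (Idt C A) \<one>\<^bsub>Hom C A N\<^esub>"
    using obj(1) by (intro iso_biproduct_zero) (auto simp: N Idt_iso_arrow Idt_closed Cmp_Idt_left)
  then show thesis
    using conflation_sum[OF assms(1) Q _ assms(2,3)] that by blast
qed

end

section \<open>Extensions in a subcategory of projective objects\<close>

locale indexed_category = extriangulated_category C
  for C :: "('o, 'm, 'e) extri" (structure) +
  fixes T :: "'o set" and T0 T1 :: "'o \<Rightarrow> 'o" and a b :: "'o \<Rightarrow> 'm"
  assumes T_subcategory: "full_additive_subcategory C T"
    and T_iso_stable: "iso_stable C T"
    and T_projective: "P \<in> T \<Longrightarrow> projective C P"
    and presentation:
      "X \<in> Obj C \<Longrightarrow> T1 X \<in> T \<and> T0 X \<in> T \<and> conflation C (T1 X) (a X) (T0 X) (b X) X"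
begin

abbreviation K0T :: "('o \<Rightarrow>\<^sub>0 int) set monoid" where
  "K0T \<equiv> K0 (full_sub C T)"

abbreviation class_T :: "'o \<Rightarrow> ('o \<Rightarrow>\<^sub>0 int) set" where
  "class_T \<equiv> K0_class (full_sub C T)"

lemma T_Obj: "A \<in> T \<Longrightarrow> A \<in> Obj C"
  using T_subcategory unfolding full_additive_subcategory_def by blast

lemma full_sub_simps [simp]:
  "Obj (full_sub C T) = T" "Hom (full_sub C T) = Hom C" "Idt (full_sub C T) = Idt C"
  "Cmp (full_sub C T) = Cmp C"
  by (simp_all add: full_sub_def)

lemma conflation_full_sub:
  "conflation (full_sub C T) X x Y y Z \<longleftrightarrow>
    conflation C X x Y y Z \<and> X \<in> T \<and> Y \<in> T \<and> Z \<in> T"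
  unfolding conflation_def realizes_def full_sub_def using T_Obj by auto

lemma T_biproduct:
  assumes "A \<in> T" "B \<in> T"
  obtains S i j p q where "S \<in> T" "biproduct C A B S i j p q"
proof -
  interpret T: additive_category "full_sub C T"
    using T_subcategory unfolding full_additive_subcategory_def by blast
  obtain S i j p q where "biproduct (full_sub C T) A B S i j p q"
    using T.ex_biproduct[of A B] assms by auto
  then show thesis
    using that T_Obj unfolding biproduct_def by auto
qed

text \<open>
  A zero object of the subcategory is a zero object of the whole category, because its identity
  is the zero morphism.
\<close>

lemma T_zero_object:
  obtains N where "N \<in> T" "zero_object C N"
proof -
  interpret T: additive_category "full_sub C T"
    using T_subcategory unfolding full_additive_subcategory_def by blast
  obtain N where N: "N \<in> T" "trivial_group (Hom C N N)"
    using T.ex_zero_object unfolding zero_object_def by auto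
  have obj: "N \<in> Obj C"
    using T_Obj N(1) .
  have idN: "Idt C N = \<one>\<^bsub>Hom C N N\<^esub>"
    using N(2) Idt_closed[OF obj] unfolding trivial_group_def by blast
  have from_N: "f = \<one>\<^bsub>Hom C N X\<^esub>" if "X \<in> Obj C" "f \<in> carrier (Hom C N X)" for X f
    using Cmp_Idt_right[OF obj that] Cmp_zero_right[OF obj obj that] by (simp add: idN)
  have to_N: "f = \<one>\<^bsub>Hom C X N\<^esub>" if "X \<in> Obj C" "f \<in> carrier (Hom C X N)" for X f
    using Cmp_Idt_left[OF that(1) obj that(2)] Cmp_zero_left[OF that(1) obj obj that(2)]
    by (simp add: idN)
  have "trivial_group (Hom C N X)" "trivial_group (Hom C X N)" if "X \<in> Obj C" for X
    unfolding trivial_group_def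
    using Hom_group obj that from_N[OF that] to_N[OF that] zero_arrow_closed by blast+
  then show thesis
    using that[OF N(1)] obj unfolding zero_object_def by blast
qed

sublocale K: grothendieck_group C
  using conflation_closed by unfold_locales blast

sublocale KT: grothendieck_group "full_sub C T"
  using conflation_full_sub by unfold_locales simp

sublocale G: comm_group K0T
  by (rule KT.K0_comm_group)

lemma class_T_closed [simp]: "A \<in> T \<Longrightarrow> class_T A \<in> carrier K0T"
  using KT.K0_class_closed by simp

lemma class_T_conflation:
  assumes "conflation C A x B y D" "A \<in> T" "B \<in> T" "D \<in> T"
  shows "class_T B = class_T A \<otimes>\<^bsub>K0T\<^esub> class_T D"
  using KT.K0_class_conflation[of A x B y D] assms by (simp add: conflation_full_sub)

lemma class_T_zero:
  assumes "N \<in> T" "zero_object C N"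
  shows "class_T N = \<one>\<^bsub>K0T\<^esub>"
proof -
  have "N \<in> Obj C"
    using assms(1) by (rule T_Obj)
  then obtain x where "conflation C N x N (Idt C N) N"
    using iso_is_deflation[OF _ _ Idt_iso_arrow assms(2)] by metis
  then have "class_T N = class_T N \<otimes>\<^bsub>K0T\<^esub> class_T N"
    using class_T_conflation assms(1) by blast
  then show ?thesis
    using G.l_cancel_one[OF class_T_closed[OF assms(1)] class_T_closed[OF assms(1)]] by simp
qed

lemma T_iso:
  assumes "iso_arrow C A B f" "A \<in> Obj C" "B \<in> T"
  shows "A \<in> T" "class_T A = class_T B"
proof -
  obtain N where N: "N \<in> T" "zero_object C N"
    by (rule T_zero_object)
  show A: "A \<in> T"
    using T_iso_stable assms iso_arrow_sym[OF assms(1)] unfolding iso_stable_def by metis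
  obtain x where "conflation C N x A f B"
    using iso_is_deflation[OF assms(2) T_Obj[OF assms(3)] assms(1) N(2)] by metis
  then have "class_T A = class_T N \<otimes>\<^bsub>K0T\<^esub> class_T B"
    using class_T_conflation A N(1) assms(3) by blast
  then show "class_T A = class_T B"
    using class_T_zero[OF N] assms(3) by simp
qed

lemma projective_splits:
  assumes "conflation C A x B y P" "projective C P" "biproduct C A P S i j p q"
  obtains g where "iso_arrow C S B g"
proof -
  obtain \<delta> where \<delta>: "realizes C P A \<delta> x B y"
    using assms(1) unfolding conflation_def by blast
  have "\<delta> = \<one>\<^bsub>Ext C P A\<^esub>"
    using realizes_closed[OF \<delta>] assms(2) unfolding projective_def trivial_group_def by auto
  then show thesis
    using realizes_unique[OF biproduct_realizes[OF assms(3)]] \<delta> that by blast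
qed

lemma T_extension_closed:
  assumes "conflation C A x B y P" "A \<in> T" "P \<in> T"
  shows "B \<in> T" "class_T B = class_T A \<otimes>\<^bsub>K0T\<^esub> class_T P"
proof -
  obtain S i j p q where S: "S \<in> T" "biproduct C A P S i j p q"
    using assms(2,3) by (rule T_biproduct)
  obtain g where "iso_arrow C S B g"
    by (rule projective_splits[OF assms(1) T_projective[OF assms(3)] S(2)])
  then show B: "B \<in> T"
    using T_iso_stable S(1) conflation_closed[OF assms(1)] unfolding iso_stable_def by blast
  show "class_T B = class_T A \<otimes>\<^bsub>K0T\<^esub> class_T P"
    using class_T_conflation[OF assms(1,2) B assms(3)] .
qed


section \<open>The index\<close>

lemma K0_diff_closed: "\<lbrakk>A \<in> T; B \<in> T\<rbrakk> \<Longrightarrow> K0_diff C T A B \<in> carrier K0T"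
  unfolding K0_diff_def by simp

lemma K0_diff_eqI:
  assumes "A \<in> T" "B \<in> T" "A' \<in> T" "B' \<in> T"
    "class_T A \<otimes>\<^bsub>K0T\<^esub> class_T B' = class_T A' \<otimes>\<^bsub>K0T\<^esub> class_T B"
  shows "K0_diff C T A B = K0_diff C T A' B'"
proof -
  have cl: "class_T A \<in> carrier K0T" "class_T B \<in> carrier K0T"
    "class_T A' \<in> carrier K0T" "class_T B' \<in> carrier K0T"
    using assms by auto
  have "class_T A = class_T A' \<otimes>\<^bsub>K0T\<^esub> class_T B \<otimes>\<^bsub>K0T\<^esub> inv\<^bsub>K0T\<^esub> class_T B'"
    using G.inv_solve_right[of "class_T A" "class_T A' \<otimes>\<^bsub>K0T\<^esub> class_T B" "class_T B'"] cl assms(5)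
    by simp
  then have "K0_diff C T A B
      = class_T A' \<otimes>\<^bsub>K0T\<^esub> (class_T B \<otimes>\<^bsub>K0T\<^esub> inv\<^bsub>K0T\<^esub> class_T B') \<otimes>\<^bsub>K0T\<^esub> inv\<^bsub>K0T\<^esub> class_T B"
    unfolding K0_diff_def using cl by (simp add: G.m_assoc)
  also have "\<dots> = class_T A' \<otimes>\<^bsub>K0T\<^esub> inv\<^bsub>K0T\<^esub> class_T B'
      \<otimes>\<^bsub>K0T\<^esub> (class_T B \<otimes>\<^bsub>K0T\<^esub> inv\<^bsub>K0T\<^esub> class_T B)"
    using cl by (simp only: G.m_ac G.inv_closed G.m_closed)
  finally show ?thesis
    unfolding K0_diff_def using cl by simp
qed

lemma K0_diff_add:
  assumes "A \<in> T" "B \<in> T" "A' \<in> T" "B' \<in> T" "F \<in> T" "K \<in> T"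
    "class_T F = class_T A \<otimes>\<^bsub>K0T\<^esub> class_T A'" "class_T K = class_T B \<otimes>\<^bsub>K0T\<^esub> class_T B'"
  shows "K0_diff C T F K = K0_diff C T A B \<otimes>\<^bsub>K0T\<^esub> K0_diff C T A' B'"
proof -
  have cl: "class_T A \<in> carrier K0T" "class_T B \<in> carrier K0T"
    "class_T A' \<in> carrier K0T" "class_T B' \<in> carrier K0T"
    using assms by auto
  show ?thesis
    unfolding K0_diff_def assms(7,8) G.inv_mult[OF cl(2,4)]
    using cl by (simp only: G.m_ac G.inv_closed G.m_closed)
qed

text \<open>
  Schanuel's lemma: the pullback \<open>M\<close> of the two deflations onto \<open>X\<close> is an extension of \<open>S0\<close> by
  \<open>S1'\<close> and also of \<open>S0'\<close> by \<open>S1\<close>, up to isomorphism of the quotients. Both extensions split, so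
  \<open>[S0] + [S1'] = [M] = [S0'] + [S1]\<close>.
\<close>

lemma index_unique:
  assumes "conflation C S1 c S0 d X" "conflation C S1' c' S0' d' X"
    and T: "S0 \<in> T" "S1 \<in> T" "S0' \<in> T" "S1' \<in> T"
  shows "K0_diff C T S0 S1 = K0_diff C T S0' S1'"
proof -
  obtain M w1 z1 B1 g1 w2 z2 B2 g2 where
    M1: "conflation C S1' w1 M z1 B1" "iso_arrow C B1 S0 g1" and
    M2: "conflation C S1 w2 M z2 B2" "iso_arrow C B2 S0' g2"
    by (rule pullback_of_deflations[OF assms(1,2)])
  note B1 = T_iso[OF M1(2) conflation_closed(3)[OF M1(1)] T(1)]
  note B2 = T_iso[OF M2(2) conflation_closed(3)[OF M2(1)] T(3)]
  have "class_T M = class_T S1' \<otimes>\<^bsub>K0T\<^esub> class_T S0"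
    using T_extension_closed(2)[OF M1(1) T(4) B1(1)] B1(2) by simp
  moreover have "class_T M = class_T S1 \<otimes>\<^bsub>K0T\<^esub> class_T S0'"
    using T_extension_closed(2)[OF M2(1) T(2) B2(1)] B2(2) by simp
  ultimately show ?thesis
    using T by (intro K0_diff_eqI) (auto simp: G.m_comm)
qed

lemma ind_eq:
  assumes "conflation C S1 c S0 d X" "S0 \<in> T" "S1 \<in> T"
  shows "K0_diff C T S0 S1 = ind C T T0 T1 X"
  unfolding ind_def
  using index_unique[OF assms(1)] presentation conflation_closed(3)[OF assms(1)] assms(2,3) by blast

lemma ind_closed: "X \<in> Obj C \<Longrightarrow> ind C T T0 T1 X \<in> carrier K0T"
  unfolding ind_def using K0_diff_closed presentation by blast

text \<open>
  Composing a presentation \<open>K \<rightarrow> F \<rightarrow> Y'\<close> with an isomorphism \<open>Y' \<cong> Y\<close> gives a presentation of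
  \<open>Y\<close> whose kernel is an extension of a zero object by \<open>K\<close>.
\<close>

lemma presentation_iso:
  assumes "conflation C K h F e Y'" "iso_arrow C Y' Y g" "Y \<in> Obj C" "K \<in> T"
  obtains K' h' e' where "conflation C K' h' F e' Y" "K' \<in> T" "class_T K' = class_T K"
proof -
  obtain N where N: "N \<in> T" "zero_object C N"
    by (rule T_zero_object)
  obtain x where g: "conflation C N x Y' g Y"
    using iso_is_deflation[OF conflation_closed(3)[OF assms(1)] assms(3,2) N(2)] by blast
  obtain K' h' d k where c: "conflation C K' h' F (g \<cdot> e) Y" "conflation C K d K' k N"
    by (rule deflations_compose[OF g assms(1)])
  have "K' \<in> T" "class_T K' = class_T K"
    using T_extension_closed[OF c(2) assms(4) N(1)] class_T_zero[OF N] assms(4) by simp_all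
  then show thesis
    by (rule that[OF c(1)])
qed

text \<open>
  The horseshoe lemma. Let \<open>M\<close> be the pullback of \<open>Y \<rightarrow> Z\<close> along the presentation
  \<open>T0 Z \<rightarrow> Z\<close>. It is an extension of the projective \<open>T0 Z\<close> by \<open>X\<close>, hence \<open>M \<cong> X \<oplus> T0 Z\<close>, and
  \<open>T0 X \<oplus> T0 Z \<rightarrow> M\<close> is a deflation with kernel \<open>T1 X\<close>. It is also an extension of \<open>Y\<close> by
  \<open>T1 Z\<close>, so the composite \<open>T0 X \<oplus> T0 Z \<rightarrow> Y\<close> is a deflation whose kernel is an extension of
  \<open>T1 Z\<close> by \<open>T1 X\<close>.
\<close>

lemma ind_additive:
  assumes "conflation C X x Y y Z"
  shows "ind C T T0 T1 Y = ind C T T0 T1 X \<otimes>\<^bsub>K0T\<^esub> ind C T T0 T1 Z"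
proof -
  note obj = conflation_closed[OF assms]
  have pX: "conflation C (T1 X) (a X) (T0 X) (b X) X" and TX: "T1 X \<in> T" "T0 X \<in> T"
    using presentation[OF obj(1)] by auto
  have pZ: "conflation C (T1 Z) (a Z) (T0 Z) (b Z) Z" and TZ: "T1 Z \<in> T" "T0 Z \<in> T"
    using presentation[OF obj(3)] by auto
  obtain M w1 z1 Y' g w2 z2 Q g2 where
    MY: "conflation C (T1 Z) w1 M z1 Y'" "iso_arrow C Y' Y g" and
    MQ: "conflation C X w2 M z2 Q" "iso_arrow C Q (T0 Z) g2"
    by (rule pullback_of_deflations[OF assms pZ])
  note Q = T_iso[OF MQ(2) conflation_closed(3)[OF MQ(1)] TZ(2)]
  obtain S i j p q where S: "biproduct C X Q S i j p q"
    using ex_biproduct obj(1) T_Obj[OF Q(1)] by blast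
  obtain k where "iso_arrow C S M k"
    by (rule projective_splits[OF MQ(1) T_projective[OF Q(1)] S])
  then obtain i' j' p' q' where M: "biproduct C X Q M i' j' p' q'"
    by (rule biproduct_iso[OF S conflation_closed(2)[OF MQ(1)]])
  obtain F iF jF pF qF where F: "F \<in> T" "biproduct C (T0 X) Q F iF jF pF qF"
    using TX(2) Q(1) by (rule T_biproduct)
  have class_F: "class_T F = class_T (T0 X) \<otimes>\<^bsub>K0T\<^esub> class_T (T0 Z)"
    using class_T_conflation[OF _ TX(2) F(1) Q(1)] biproduct_realizes[OF F(2)] Q(2)
    unfolding conflation_def by metis
  obtain s t where "conflation C (T1 X) s F t M"
    by (rule conflation_add_object[OF pX F(2) M])
  then obtain K h d e where K: "conflation C K h F (z1 \<cdot> t) Y'" "conflation C (T1 X) d K e (T1 Z)"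
    by (rule deflations_compose[OF MY(1)])
  note KT = T_extension_closed[OF K(2) TX(1) TZ(1)]
  obtain K' h' e' where K': "conflation C K' h' F e' Y" "K' \<in> T" "class_T K' = class_T K"
    by (rule presentation_iso[OF K(1) MY(2) obj(2) KT(1)])
  have "ind C T T0 T1 Y = K0_diff C T F K'"
    using ind_eq[OF K'(1) F(1) K'(2)] by simp
  also have "\<dots> = ind C T T0 T1 X \<otimes>\<^bsub>K0T\<^esub> ind C T T0 T1 Z"
    unfolding ind_def using TX TZ F(1) K'(2) class_F K'(3) KT(2) by (intro K0_diff_add) auto
  finally show ?thesis .
qed

text \<open>An object \<open>A\<close> of \<open>T\<close> is its own presentation \<open>0 \<rightarrow> A \<rightarrow> A\<close>.\<close>

lemma ind_T:
  assumes "A \<in> T"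
  shows "ind C T T0 T1 A = class_T A"
proof -
  obtain N where N: "N \<in> T" "zero_object C N"
    by (rule T_zero_object)
  have "A \<in> Obj C"
    using assms by (rule T_Obj)
  then obtain x where "conflation C N x A (Idt C A) A"
    using iso_is_deflation[OF _ _ Idt_iso_arrow N(2)] by metis
  then have "K0_diff C T A N = ind C T T0 T1 A"
    using ind_eq assms N(1) by blast
  then show ?thesis
    unfolding K0_diff_def class_T_zero[OF N] using assms by simp
qed

text \<open>
  The inverse of the index is induced by the inclusion of \<open>T\<close>. It is enough to compare both
  composites with the identity on classes of objects: one is the index of objects of \<open>T\<close>, the other
  says that \<open>[T0 X] - [T1 X] = [X]\<close> in the Grothendieck group of the whole category.
\<close>

lemma ind_iso: "\<exists>\<phi>\<in>iso (K0 C) K0T. \<forall>X\<in>Obj C. \<phi> (K0_class C X) = ind C T T0 T1 X"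
proof -
  interpret GC: comm_group "K0 C"
    by (rule K.K0_comm_group)
  have "\<exists>\<phi>\<in>hom (K0 C) K0T. \<forall>X\<in>Obj C. \<phi> (K0_class C X) = ind C T T0 T1 X"
    by (rule K.K0_universal[OF KT.K0_comm_group]) (fact ind_closed, fact ind_additive)
  then obtain \<phi> where \<phi>: "\<phi> \<in> hom (K0 C) K0T"
      "\<And>X. X \<in> Obj C \<Longrightarrow> \<phi> (K0_class C X) = ind C T T0 T1 X"
    by blast
  have "\<exists>\<psi>\<in>hom K0T (K0 C). \<forall>A\<in>Obj (full_sub C T). \<psi> (class_T A) = K0_class C A"
  proof (rule KT.K0_universal[OF K.K0_comm_group])
    show "K0_class C A \<in> carrier (K0 C)" if "A \<in> Obj (full_sub C T)" for A
      using K.K0_class_closed T_Obj that by simp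
    show "K0_class C B = K0_class C A \<otimes>\<^bsub>K0 C\<^esub> K0_class C D"
      if "conflation (full_sub C T) A x B y D" for A x B y D
      using K.K0_class_conflation[of A x B y D] that by (simp add: conflation_full_sub)
  qed
  then obtain \<psi> where \<psi>: "\<psi> \<in> hom K0T (K0 C)" "\<And>A. A \<in> T \<Longrightarrow> \<psi> (class_T A) = K0_class C A"
    by auto
  interpret \<psi>: group_hom K0T "K0 C" \<psi>
    by (simp add: group_hom_def group_hom_axioms_def \<psi>(1) G.is_group GC.is_group)
  have "\<phi> (\<psi> u) = u" if "u \<in> carrier K0T" for u
  proof -
    have "id \<in> hom K0T K0T"
      by (simp add: hom_def)
    then have "(\<phi> \<circ> \<psi>) u = id u"
      by (rule KT.K0_hom_eqI[OF G.is_group hom_compose[OF \<psi>(1) \<phi>(1)] _ _ that])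
        (simp add: \<phi>(2) \<psi>(2) T_Obj ind_T)
    then show ?thesis by simp
  qed
  moreover have "\<psi> (\<phi> u) = u" if "u \<in> carrier (K0 C)" for u
  proof -
    have inverse_on_classes: "\<psi> (ind C T T0 T1 X) = K0_class C X" if "X \<in> Obj C" for X
    proof -
      have T: "T0 X \<in> T" "T1 X \<in> T" and c: "conflation C (T1 X) (a X) (T0 X) (b X) X"
        using presentation[OF that] by auto
      have cl: "K0_class C X \<in> carrier (K0 C)" "K0_class C (T1 X) \<in> carrier (K0 C)"
        using that T T_Obj K.K0_class_closed by auto
      have "\<psi> (ind C T T0 T1 X) = K0_class C (T0 X) \<otimes>\<^bsub>K0 C\<^esub> inv\<^bsub>K0 C\<^esub> K0_class C (T1 X)"
        unfolding ind_def K0_diff_def using T \<psi>(2) by simp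
      also have "\<dots> = K0_class C X \<otimes>\<^bsub>K0 C\<^esub> K0_class C (T1 X) \<otimes>\<^bsub>K0 C\<^esub> inv\<^bsub>K0 C\<^esub> K0_class C (T1 X)"
        using K.K0_class_conflation[OF c] cl by (simp add: GC.m_comm)
      also have "\<dots> = K0_class C X"
        using cl by (simp add: GC.m_assoc)
      finally show ?thesis .
    qed
    have "id \<in> hom (K0 C) (K0 C)"
      by (simp add: hom_def)
    then have "(\<psi> \<circ> \<phi>) u = id u"
      by (rule K.K0_hom_eqI[OF GC.is_group hom_compose[OF \<phi>(1) \<psi>(1)] _ _ that])
        (simp add: \<phi>(2) inverse_on_classes)
    then show ?thesis by simp
  qed
  ultimately have "group_isomorphisms (K0 C) K0T \<phi> \<psi>"
    unfolding group_isomorphisms_def using \<phi>(1) \<psi>(1) by blast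
  then have "\<phi> \<in> iso (K0 C) K0T"
    by (rule group_isomorphisms_imp_iso)
  then show ?thesis
    using \<phi>(2) by blast
qed

end

theorem proposition4p11:
  fixes C :: "('o, 'm, 'e) extri"
    and T :: "'o set"
    and T0 T1 :: "'o \<Rightarrow> 'o"
    and a b :: "'o \<Rightarrow> 'm"
  assumes "extriangulated_category C"
    and "full_additive_subcategory C T"
    and "iso_stable C T"
    and "summand_stable C T"
    and "\<And>P. P \<in> T \<Longrightarrow> projective C P"
    and "\<And>P O'. \<lbrakk>P \<in> T; zero_object C O'\<rbrakk> \<Longrightarrow> inflation C P O' \<one>\<^bsub>Hom C P O'\<^esub>"
    and "\<And>X. X \<in> Obj C \<Longrightarrow> T1 X \<in> T \<and> T0 X \<in> T \<and> conflation C (T1 X) (a X) (T0 X) (b X) X"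
  shows "(\<forall>X\<in>Obj C. \<forall>S0\<in>T. \<forall>S1\<in>T. \<forall>c d.
            conflation C S1 c S0 d X \<longrightarrow> K0_diff C T S0 S1 = ind C T T0 T1 X) \<and>
         (\<exists>\<phi>\<in>iso (K0 C) (K0 (full_sub C T)). \<forall>X\<in>Obj C. \<phi> (K0_class C X) = ind C T T0 T1 X)"
proof -
  interpret extriangulated_category C by fact
  interpret indexed_category C T T0 T1 a b
    by unfold_locales (use assms in auto)
  show ?thesis
    using ind_eq ind_iso by blast
qed

end
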